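(* Let $X\subset\mathbb{R}^n$ be a non-empty open bounded definable set and $f:X\to\mathbb{R}$ a continuous definable function which is not independent of $x_n$. Then $f$ is monotone (in particular $X$ is semi-monotone) if and only if: (i) for each $j=1,\dots,n$, $f$ is strictly increasing in, strictly decreasing in, or independent of $x_j$; (ii) the functions $\inf_{x_n}f$ and $\sup_{x_n}f$, defined on the projection $X'$ of $X$ to $\mathrm{span}\{x_1,\dots,x_{n-1}\}$ by $(\inf_{x_n}f)(x')=\inf\{f(x',t)\mid (x',t)\in X\}$ and $(\sup_{x_n}f)(x')=\sup\{f(x',t)\mid (x',t)\in X\}$, are submonotone and supermonotone, respectively; (iii) the intersection of $X$ with any straight line parallel to the $x_n$-axis is either empty or an open interval; (iv) for each $a\in\mathbb{R}$ with $X\cap\{x_n=a\}$ non-empty, the restriction of $f$ to $X\cap\{x_n=a\}$ is a monotone function (of $x_1,\dots,x_{n-1}$).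
   Context: Fix an o-minimal structure over $\mathbb{R}$; all sets and functions are definable. The empty set is connected. A coordinate cone in $\mathbb{R}^N$ is a set $\{z\mid z_{j_1}\sigma_1c_1,\dots,z_{j_m}\sigma_mc_m\}$ ($0\le m\le N$, distinct indices, $\sigma_i\in\{<,=,>\}$, $c_i\in\mathbb{R}$). A set is semi-monotone if it is open, bounded, definable and meets every coordinate cone in a connected set. A definable $f$ on open $X\subset\mathbb{R}^n$ is strictly increasing (resp. decreasing) in $x_j$ if $f(\mathbf{x})<f(\mathbf{y})$ (resp. $>$) whenever $\mathbf{x},\mathbf{y}\in X$ differ only in coordinate $j$ with $x_j<y_j$, and independent of $x_j$ if $f(\mathbf{x})=f(\mathbf{y})$ for such pairs. A bounded upper semicontinuous $f$ on a non-empty semi-monotone $X$ is submonotone if $\{\mathbf{x}\in X\mid f(\mathbf{x})<b\}$ is semi-monotone for every $b$; $f$ is supermonotone if $-f$ is submonotone. A definable function on a non-empty semi-monotone set is monotone if it is both sub- and supermonotone and for each $j$ it is strictly increasing in, strictly decreasing in, or independent of $x_j$. *)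

theory Defs
  imports "HOL-Analysis.Analysis"
begin

text \<open>
  Real \<open>n\<close>-space is \<^const>\<open>Euclidean_space\<close> \<open>n\<close>: a point is a function \<open>nat \<Rightarrow> real\<close> that
  vanishes at all indices \<open>\<ge> n\<close>, with coordinates \<open>x 0, \<dots>, x (n - 1)\<close>.  The mathematical coordinate
  \<open>x\<^sub>j\<close> (\<open>1 \<le> j \<le> n\<close>) is thus \<open>x (j - 1)\<close>, and \<open>(n - 1)\<close>-space is literally
  the subspace \<open>span {x\<^sub>1, \<dots>, x\<^sub>n\<^sub>-\<^sub>1}\<close> of \<open>n\<close>-space.
\<close>

abbreviation rspace :: "nat \<Rightarrow> (nat \<Rightarrow> real) set"
  where "rspace n \<equiv> topspace (Euclidean_space n)"

inductive_set polyfuns :: "nat \<Rightarrow> ((nat \<Rightarrow> real) \<Rightarrow> real) set" for n :: nat where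
  const: "(\<lambda>x. c) \<in> polyfuns n"
| coord: "i < n \<Longrightarrow> (\<lambda>x. x i) \<in> polyfuns n"
| add: "p \<in> polyfuns n \<Longrightarrow> q \<in> polyfuns n \<Longrightarrow> (\<lambda>x. p x + q x) \<in> polyfuns n"
| mult: "p \<in> polyfuns n \<Longrightarrow> q \<in> polyfuns n \<Longrightarrow> (\<lambda>x. p x * q x) \<in> polyfuns n"

definition algebraic_set :: "nat \<Rightarrow> (nat \<Rightarrow> real) set \<Rightarrow> bool" where
  "algebraic_set n A \<longleftrightarrow>
     (\<exists>P. finite P \<and> P \<subseteq> polyfuns n \<and> A = {x \<in> rspace n. \<forall>p\<in>P. p x = 0})"

definition append_point :: "nat \<Rightarrow> (nat \<Rightarrow> real) \<Rightarrow> (nat \<Rightarrow> real) \<Rightarrow> nat \<Rightarrow> real" where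
  "append_point m x y = (\<lambda>i. if i < m then x i else y (i - m))"

text \<open>
  \<open>S n\<close> is the collection of definable subsets of \<open>n\<close>-space.  ``Over the reals'' is read as: expanding
  the real field, i.e. all real algebraic sets are definable.  In the last axiom,
  \<^const>\<open>is_interval\<close> covers bounded and unbounded intervals of all kinds as well as single points.
\<close>

locale o_minimal_structure =
  fixes S :: "nat \<Rightarrow> (nat \<Rightarrow> real) set set"
  assumes definable_subset: "A \<in> S n \<Longrightarrow> A \<subseteq> rspace n"
    and definable_algebraic: "algebraic_set n A \<Longrightarrow> A \<in> S n"
    and definable_compl: "A \<in> S n \<Longrightarrow> rspace n - A \<in> S n"
    and definable_Un: "A \<in> S n \<Longrightarrow> B \<in> S n \<Longrightarrow> A \<union> B \<in> S n"
    and definable_Int: "A \<in> S n \<Longrightarrow> B \<in> S n \<Longrightarrow> A \<inter> B \<in> S n"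
    and definable_times:
      "A \<in> S m \<Longrightarrow> B \<in> S n \<Longrightarrow> {append_point m x y | x y. x \<in> A \<and> y \<in> B} \<in> S (m + n)"
    and definable_proj: "A \<in> S (Suc n) \<Longrightarrow> (\<lambda>x. x(n := 0)) ` A \<in> S n"
    and o_minimal:
      "A \<in> S 1 \<longleftrightarrow>
        (\<exists>\<I>. finite \<I> \<and> (\<forall>I\<in>\<I>. is_interval I) \<and> A = {x \<in> rspace 1. x 0 \<in> \<Union>\<I>})"

text \<open>
  A function on a set \<open>X\<close> is represented by a total function together with \<open>X\<close>; only its
  values on \<open>X\<close> matter.  Definability is definability of the graph in \<open>(n + 1)\<close>-space.
\<close>

definition definable_fun ::
    "(nat \<Rightarrow> (nat \<Rightarrow> real) set set) \<Rightarrow> nat \<Rightarrow> (nat \<Rightarrow> real) set \<Rightarrow> ((nat \<Rightarrow> real) \<Rightarrow> real) \<Rightarrow> bool" where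
  "definable_fun S n X f \<longleftrightarrow> X \<subseteq> rspace n \<and> {x(n := f x) | x. x \<in> X} \<in> S (Suc n)"

definition bounded_in :: "nat \<Rightarrow> (nat \<Rightarrow> real) set \<Rightarrow> bool" where
  "bounded_in n X \<longleftrightarrow> (\<exists>B. \<forall>x\<in>X. L2_set x {..<n} \<le> B)"

definition coordinate_cone :: "nat \<Rightarrow> (nat \<Rightarrow> real) set \<Rightarrow> bool" where
  "coordinate_cone N C \<longleftrightarrow>
     (\<exists>J \<sigma> c. J \<subseteq> {..<N} \<and> (\<forall>j\<in>J. \<sigma> j \<in> {(<), (=), (>)}) \<and>
        C = {z \<in> rspace N. \<forall>j\<in>J. \<sigma> j (z j) (c j)})"

definition semi_monotone :: "(nat \<Rightarrow> (nat \<Rightarrow> real) set set) \<Rightarrow> nat \<Rightarrow> (nat \<Rightarrow> real) set \<Rightarrow> bool" where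
  "semi_monotone S n X \<longleftrightarrow>
     openin (Euclidean_space n) X \<and> bounded_in n X \<and> X \<in> S n \<and>
     (\<forall>C. coordinate_cone n C \<longrightarrow> connectedin (Euclidean_space n) (X \<inter> C))"

definition strictly_increasing_in :: "nat \<Rightarrow> (nat \<Rightarrow> real) set \<Rightarrow> ((nat \<Rightarrow> real) \<Rightarrow> real) \<Rightarrow> bool" where
  "strictly_increasing_in j X f \<longleftrightarrow>
     (\<forall>x\<in>X. \<forall>y\<in>X. (\<forall>i. i \<noteq> j \<longrightarrow> x i = y i) \<and> x j < y j \<longrightarrow> f x < f y)"

definition strictly_decreasing_in :: "nat \<Rightarrow> (nat \<Rightarrow> real) set \<Rightarrow> ((nat \<Rightarrow> real) \<Rightarrow> real) \<Rightarrow> bool" where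
  "strictly_decreasing_in j X f \<longleftrightarrow>
     (\<forall>x\<in>X. \<forall>y\<in>X. (\<forall>i. i \<noteq> j \<longrightarrow> x i = y i) \<and> x j < y j \<longrightarrow> f x > f y)"

definition independent_of :: "nat \<Rightarrow> (nat \<Rightarrow> real) set \<Rightarrow> ((nat \<Rightarrow> real) \<Rightarrow> real) \<Rightarrow> bool" where
  "independent_of j X f \<longleftrightarrow>
     (\<forall>x\<in>X. \<forall>y\<in>X. (\<forall>i. i \<noteq> j \<longrightarrow> x i = y i) \<and> x j < y j \<longrightarrow> f x = f y)"

definition coordinatewise_monotone ::
    "nat \<Rightarrow> (nat \<Rightarrow> real) set \<Rightarrow> ((nat \<Rightarrow> real) \<Rightarrow> real) \<Rightarrow> bool" where
  "coordinatewise_monotone n X f \<longleftrightarrow>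
     (\<forall>j<n. strictly_increasing_in j X f \<or> strictly_decreasing_in j X f \<or> independent_of j X f)"

definition upper_semicontinuous ::
    "nat \<Rightarrow> (nat \<Rightarrow> real) set \<Rightarrow> ((nat \<Rightarrow> real) \<Rightarrow> real) \<Rightarrow> bool" where
  "upper_semicontinuous n X f \<longleftrightarrow>
     (\<forall>x\<in>X. \<forall>b. f x < b \<longrightarrow>
        (\<exists>U. openin (Euclidean_space n) U \<and> x \<in> U \<and> (\<forall>y\<in>U \<inter> X. f y < b)))"

definition submonotone ::
    "(nat \<Rightarrow> (nat \<Rightarrow> real) set set) \<Rightarrow> nat \<Rightarrow> (nat \<Rightarrow> real) set \<Rightarrow> ((nat \<Rightarrow> real) \<Rightarrow> real) \<Rightarrow> bool" where
  "submonotone S n X f \<longleftrightarrow>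
     X \<noteq> {} \<and> semi_monotone S n X \<and> definable_fun S n X f \<and>
     bounded (f ` X) \<and> upper_semicontinuous n X f \<and>
     (\<forall>b. semi_monotone S n {x \<in> X. f x < b})"

definition supermonotone ::
    "(nat \<Rightarrow> (nat \<Rightarrow> real) set set) \<Rightarrow> nat \<Rightarrow> (nat \<Rightarrow> real) set \<Rightarrow> ((nat \<Rightarrow> real) \<Rightarrow> real) \<Rightarrow> bool" where
  "supermonotone S n X f \<longleftrightarrow> submonotone S n X (\<lambda>x. - f x)"

definition monotone_fun ::
    "(nat \<Rightarrow> (nat \<Rightarrow> real) set set) \<Rightarrow> nat \<Rightarrow> (nat \<Rightarrow> real) set \<Rightarrow> ((nat \<Rightarrow> real) \<Rightarrow> real) \<Rightarrow> bool" where
  "monotone_fun S n X f \<longleftrightarrow>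
     X \<noteq> {} \<and> semi_monotone S n X \<and> definable_fun S n X f \<and>
     submonotone S n X f \<and> supermonotone S n X f \<and> coordinatewise_monotone n X f"

text \<open>For \<open>n \<ge> 1\<close> and \<open>x'\<close> in \<open>(n - 1)\<close>-space, the point \<open>(x', t)\<close> of \<open>n\<close>-space is \<open>x'(n - 1 := t)\<close>.\<close>

definition proj_last :: "nat \<Rightarrow> (nat \<Rightarrow> real) set \<Rightarrow> (nat \<Rightarrow> real) set" where
  "proj_last n X = (\<lambda>x. x(n - 1 := 0)) ` X"

definition fibre_last :: "nat \<Rightarrow> (nat \<Rightarrow> real) set \<Rightarrow> (nat \<Rightarrow> real) \<Rightarrow> real set" where
  "fibre_last n X x' = {t. x'(n - 1 := t) \<in> X}"

definition fibre_values ::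
    "nat \<Rightarrow> (nat \<Rightarrow> real) set \<Rightarrow> ((nat \<Rightarrow> real) \<Rightarrow> real) \<Rightarrow> (nat \<Rightarrow> real) \<Rightarrow> real set" where
  "fibre_values n X f x' = {f (x'(n - 1 := t)) | t. x'(n - 1 := t) \<in> X}"

text \<open>
  \<^const>\<open>Inf\<close> and \<^const>\<open>Sup\<close> on \<^typ>\<open>real\<close> are meaningful only on non-empty sets bounded below, resp.
  above; wherever the following two functions are used, boundedness of \<^const>\<open>fibre_values\<close> has to be
  required in addition.
\<close>

definition inf_last ::
    "nat \<Rightarrow> (nat \<Rightarrow> real) set \<Rightarrow> ((nat \<Rightarrow> real) \<Rightarrow> real) \<Rightarrow> (nat \<Rightarrow> real) \<Rightarrow> real" where
  "inf_last n X f x' = Inf (fibre_values n X f x')"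

definition sup_last ::
    "nat \<Rightarrow> (nat \<Rightarrow> real) set \<Rightarrow> ((nat \<Rightarrow> real) \<Rightarrow> real) \<Rightarrow> (nat \<Rightarrow> real) \<Rightarrow> real" where
  "sup_last n X f x' = Sup (fibre_values n X f x')"

text \<open>The slice \<open>X \<inter> {x\<^sub>n = a}\<close>, viewed as a subset of \<open>(n - 1)\<close>-space.\<close>

definition slice_last :: "nat \<Rightarrow> (nat \<Rightarrow> real) set \<Rightarrow> real \<Rightarrow> (nat \<Rightarrow> real) set" where
  "slice_last n X a = {x' \<in> rspace (n - 1). x'(n - 1 := a) \<in> X}"

end

theory Submission
  imports Defs
begin

text \<open>
  Writing \<open>sup\<^sub>x\<^sub>n f = - inf\<^sub>x\<^sub>n (- f)\<close>, it suffices to relate submonotonicity of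
  \<open>f\<close> to that of \<open>inf\<^sub>x\<^sub>n f\<close> and of the slices of \<open>f\<close>.  Since
  \<open>{inf\<^sub>x\<^sub>n f < b}\<close> is the projection of \<open>{f < b}\<close>, the forward direction says that
  projections and slices of semi-monotone sets are semi-monotone.  Conversely, let \<open>Y = {f < b}\<close> and let
  \<open>C'\<close> be a cone in the first \<open>n - 1\<close> coordinates.  The part of \<open>Y\<close> over \<open>C'\<close> is connected, because
  the projection is an open map with interval fibres onto a connected set; its part in the wall \<open>x\<^sub>n = a\<close>
  is connected by assumption on the slices; and for an open set connectedness of both implies
  connectedness of the part on either side of the wall.
\<close>

section \<open>Definable sets and functions\<close>

context o_minimal_structure
begin

section \<open>First-order operations and coordinate changes on definable sets\<close>

lemma definable_rspace: "rspace n \<in> S n"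
  by (rule definable_algebraic) (auto simp: algebraic_set_def intro!: exI[of _ "{}"])

lemma definable_Collect_conj:
  assumes "{x \<in> rspace n. P x} \<in> S n" "{x \<in> rspace n. Q x} \<in> S n"
  shows "{x \<in> rspace n. P x \<and> Q x} \<in> S n"
proof -
  have "{x \<in> rspace n. P x \<and> Q x} = {x \<in> rspace n. P x} \<inter> {x \<in> rspace n. Q x}" by blast
  then show ?thesis using definable_Int[OF assms] by simp
qed

lemma definable_Collect_mem:
  assumes "A \<in> S n"
  shows "{x \<in> rspace n. x \<in> A} \<in> S n"
  using definable_Int[OF definable_rspace assms] by (simp add: Int_def)

text \<open>An existential quantifier is a projection: the bound variable lives in the extra
  coordinate \<open>n\<close>. Together with the rules for conjunction and complement this lets a
  formula be translated clause by clause.\<close>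

lemma definable_Collect_ex:
  assumes "{x \<in> rspace (Suc n). P x} \<in> S (Suc n)"
  shows "{x \<in> rspace n. \<exists>t. P (x(n := t))} \<in> S n"
proof -
  have "{x \<in> rspace n. \<exists>t. P (x(n := t))} = (\<lambda>x. x(n := 0)) ` {x \<in> rspace (Suc n). P x}"
  proof (intro equalityI subsetI)
    fix x assume x: "x \<in> {x \<in> rspace n. \<exists>t. P (x(n := t))}"
    then obtain t where "P (x(n := t))" by blast
    moreover have "x(n := t) \<in> rspace (Suc n)" "x = x(n := t, n := 0)"
      using x by (auto simp: topspace_Euclidean_space)
    ultimately show "x \<in> (\<lambda>x. x(n := 0)) ` {x \<in> rspace (Suc n). P x}"
      by blast
  next
    fix x assume "x \<in> (\<lambda>x. x(n := 0)) ` {x \<in> rspace (Suc n). P x}"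
    then obtain z where z: "z \<in> rspace (Suc n)" "P z" "x = z(n := 0)" by blast
    then have "P (x(n := z n))" "x \<in> rspace n"
      by (auto simp: topspace_Euclidean_space Suc_le_eq)
    then show "x \<in> {x \<in> rspace n. \<exists>t. P (x(n := t))}" by blast
  qed
  then show ?thesis using definable_proj[OF assms] by simp
qed

text \<open>Iterated projection, removing coordinate \<open>N + k\<close> down to \<open>N\<close>
  one at a time. When nothing is left to remove, truncation is the identity, because points of
  \<open>rspace N\<close> vanish from index \<open>N\<close> on.\<close>

lemma definable_truncate:
  assumes "A \<in> S (N + k)"
  shows "(\<lambda>x i. if i < N then x i else 0) ` A \<in> S N"
  using assms
proof (induction k arbitrary: A)
  case 0
  then have "A \<subseteq> rspace N" using definable_subset by force
  then have "(\<lambda>x i. if i < N then x i else 0) ` A = (\<lambda>x. x) ` A"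
    by (intro image_cong) (auto simp: topspace_Euclidean_space fun_eq_iff subset_iff)
  then show ?case using 0 by simp
next
  case (Suc k)
  then have "(\<lambda>x i. if i < N then x i else 0) ` (\<lambda>x. x(N + k := 0)) ` A \<in> S N"
    by (intro Suc.IH definable_proj) simp
  moreover have "(\<lambda>x i. if i < N then x i else 0) ` (\<lambda>x. x(N + k := 0)) ` A
      = (\<lambda>x i. if i < N then x i else 0) ` A"
    unfolding image_image by (intro image_cong) (auto simp: fun_eq_iff)
  ultimately show ?case by simp
qed

text \<open>Pull-back along a map of indices. A point of \<open>A\<close> is appended to
  \<open>x\<close> as \<open>k\<close> further coordinates, tied to \<open>x\<close> by linear
  equations, and then projected away. As \<open>\<sigma>\<close> is arbitrary, this covers
  permuting, duplicating and adding variables.\<close>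

lemma definable_Collect_reindex:
  assumes A: "A \<in> S k" and \<sigma>: "\<And>i. i < k \<Longrightarrow> \<sigma> i < N"
  shows "{x \<in> rspace N. (\<lambda>i. if i < k then x (\<sigma> i) else 0) \<in> A} \<in> S N"
proof -
  let ?tr = "\<lambda>x i. if i < N then x i else (0::real)"
  \<comment> \<open>The equation \<open>y i = x (\<sigma> i)\<close> for the appended point
    \<open>y\<close>, which starts at index \<open>N\<close>; subtraction is spelled with the
    constant -1 to match the generators of \<open>polyfuns\<close>.\<close>
  let ?P = "(\<lambda>i w. w (N + i) + (-1) * w (\<sigma> i)) ` {..<k} :: ((nat \<Rightarrow> real) \<Rightarrow> real) set"
  let ?E = "{w \<in> rspace (N + k). \<forall>p\<in>?P. p w = 0}"
  let ?B = "{append_point N x y | x y. x \<in> rspace N \<and> y \<in> A}"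
  have "?P \<subseteq> polyfuns (N + k)"
    using \<sigma> by (fastforce intro!: polyfuns.intros)
  then have "?E \<in> S (N + k)"
    by (intro definable_algebraic) (auto simp: algebraic_set_def intro!: exI[of _ ?P])
  then have "?B \<inter> ?E \<in> S (N + k)"
    by (intro definable_Int definable_times definable_rspace A)
  then have "?tr ` (?B \<inter> ?E) \<in> S N" by (rule definable_truncate)
  moreover have "?tr ` (?B \<inter> ?E) = {x \<in> rspace N. (\<lambda>i. if i < k then x (\<sigma> i) else 0) \<in> A}"
  proof (intro equalityI subsetI)
    fix u assume "u \<in> ?tr ` (?B \<inter> ?E)"
    then obtain x y where x: "x \<in> rspace N" and y: "y \<in> A"
      and E: "append_point N x y \<in> ?E" and u: "u = ?tr (append_point N x y)" by blast
    have "u = x" using x by (auto simp: u append_point_def topspace_Euclidean_space fun_eq_iff)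
    moreover have "y i = x (\<sigma> i)" if "i < k" for i
      using E that \<sigma>[OF that] by (auto simp: append_point_def)
    then have "(\<lambda>i. if i < k then x (\<sigma> i) else 0) = y"
      using definable_subset[OF A] y by (auto simp: fun_eq_iff topspace_Euclidean_space subset_iff)
    ultimately show "u \<in> {x \<in> rspace N. (\<lambda>i. if i < k then x (\<sigma> i) else 0) \<in> A}"
      using x y by simp
  next
    fix x assume "x \<in> {x \<in> rspace N. (\<lambda>i. if i < k then x (\<sigma> i) else 0) \<in> A}"
    then have x: "x \<in> rspace N" and y: "(\<lambda>i. if i < k then x (\<sigma> i) else 0) \<in> A" (is "?y \<in> A")
      by auto
    have "x = ?tr (append_point N x ?y)"
      using x by (auto simp: append_point_def topspace_Euclidean_space fun_eq_iff)
    moreover have "append_point N x ?y \<in> ?E"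
      using x \<sigma> by (auto simp: append_point_def topspace_Euclidean_space)
    ultimately show "x \<in> ?tr ` (?B \<inter> ?E)" using x y by blast
  qed
  ultimately show ?thesis by simp
qed

text \<open>The order enters here: the axiom \<open>o_minimal\<close> makes an interval definable in
  1-space, and the constant reindexing pulls it back to coordinate \<open>i\<close>.\<close>

lemma definable_Collect_coord_interval:
  assumes "is_interval I" "i < N"
  shows "{x \<in> rspace N. x i \<in> I} \<in> S N"
proof -
  have "{x \<in> rspace 1. x 0 \<in> I} \<in> S 1"
    unfolding o_minimal using assms by (intro exI[of _ "{I}"]) auto
  from definable_Collect_reindex[OF this, of "\<lambda>_. i" N] show ?thesis
    using assms(2) by (simp add: topspace_Euclidean_space)
qed

lemma definable_Collect_coord_eq:
  assumes "i < N" "j < N"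
  shows "{x \<in> rspace N. x i = a * x j} \<in> S N"
proof -
  have "(\<lambda>x. x i + (-a) * x j) \<in> polyfuns N"
    using assms by (intro polyfuns.intros)
  then show ?thesis
    by (intro definable_algebraic) (auto simp: algebraic_set_def intro!: exI[of _ "{\<lambda>x. x i + (-a) * x j}"])
qed

text \<open>A strict inequality is a polynomial equation with a positive slack:
  \<open>t + x i - x j = 0\<close> for some \<open>t > 0\<close>, with the slack as coordinate
  \<open>N\<close>.\<close>

lemma definable_Collect_coord_less:
  assumes "i < N" "j < N"
  shows "{x \<in> rspace N. x i < x j} \<in> S N"
proof -
  let ?p = "\<lambda>x. x N + (x i + (-1) * x j) :: real"
  have "?p \<in> polyfuns (Suc N)"
    using assms by (intro polyfuns.intros) auto
  then have "{x \<in> rspace (Suc N). ?p x = 0} \<in> S (Suc N)"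
    by (intro definable_algebraic) (auto simp: algebraic_set_def intro!: exI[of _ "{?p}"])
  moreover have "{x \<in> rspace (Suc N). x N \<in> {0<..}} \<in> S (Suc N)"
    by (rule definable_Collect_coord_interval) auto
  ultimately have "{x \<in> rspace N. \<exists>t. ?p (x(N := t)) = 0 \<and> (x(N := t)) N \<in> {0<..}} \<in> S N"
    by (intro definable_Collect_ex definable_Collect_conj)
  moreover have "(\<exists>t. ?p (x(N := t)) = 0 \<and> (x(N := t)) N \<in> {0<..}) \<longleftrightarrow> x i < x j" for x :: "nat \<Rightarrow> real"
  proof
    assume "x i < x j"
    then show "\<exists>t. ?p (x(N := t)) = 0 \<and> (x(N := t)) N \<in> {0<..}"
      using assms by (intro exI[of _ "x j - x i"]) auto
  qed (use assms in auto)
  ultimately show ?thesis by simp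
qed

text \<open>Coordinate \<open>Suc m\<close> stores a candidate replacement for \<open>x m\<close>,
  ready to be compared with \<open>x m\<close> and then quantified away.\<close>

lemma definable_Collect_update_last:
  assumes "A \<in> S (Suc m)"
  shows "{x \<in> rspace (Suc (Suc m)). x(m := x (Suc m), Suc m := 0) \<in> A} \<in> S (Suc (Suc m))"
proof -
  have "{x \<in> rspace (Suc (Suc m)).
      (\<lambda>i. if i < Suc m then x (if i = m then Suc m else i) else 0) \<in> A} \<in> S (Suc (Suc m))"
    by (rule definable_Collect_reindex[OF assms]) auto
  moreover have "(\<lambda>i. if i < Suc m then x (if i = m then Suc m else i) else 0)
      = x(m := x (Suc m), Suc m := 0)" if "x \<in> rspace (Suc (Suc m))" for x
    using that by (auto simp: fun_eq_iff topspace_Euclidean_space)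
  ultimately show ?thesis by (simp cong: conj_cong)
qed

text \<open>Quantifies over the stored replacement. The first two sets serve to describe infima over
  fibres; the third is the reflection taking the graph of \<open>f\<close> to that of
  \<open>- f\<close>.\<close>

lemma definable_Collect_change_last:
  assumes "A \<in> S (Suc m)"
  shows "{x \<in> rspace (Suc m). \<exists>t < x m. x(m := t) \<in> A} \<in> S (Suc m)"
    and "{x \<in> rspace (Suc m). \<exists>t > x m. x(m := t) \<in> A} \<in> S (Suc m)"
    and "{x \<in> rspace (Suc m). x(m := - x m) \<in> A} \<in> S (Suc m)"
proof -
  note upd = definable_Collect_update_last[OF assms]
  have eq: "x(Suc m := t, m := t, Suc m := 0) = x(m := t)" if "x \<in> rspace (Suc m)" for x and t :: real
    using that by (auto simp: fun_eq_iff topspace_Euclidean_space)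
  have "{x \<in> rspace (Suc m). \<exists>t. (x(Suc m := t)) (Suc m) < (x(Suc m := t)) m
      \<and> (x(Suc m := t))(m := (x(Suc m := t)) (Suc m), Suc m := 0) \<in> A} \<in> S (Suc m)"
    by (intro definable_Collect_ex definable_Collect_conj upd definable_Collect_coord_less) auto
  then show "{x \<in> rspace (Suc m). \<exists>t < x m. x(m := t) \<in> A} \<in> S (Suc m)"
    by (simp add: eq cong: conj_cong)
  have "{x \<in> rspace (Suc m). \<exists>t. (x(Suc m := t)) m < (x(Suc m := t)) (Suc m)
      \<and> (x(Suc m := t))(m := (x(Suc m := t)) (Suc m), Suc m := 0) \<in> A} \<in> S (Suc m)"
    by (intro definable_Collect_ex definable_Collect_conj upd definable_Collect_coord_less) auto
  then show "{x \<in> rspace (Suc m). \<exists>t > x m. x(m := t) \<in> A} \<in> S (Suc m)"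
    by (simp add: eq cong: conj_cong)
  have "{x \<in> rspace (Suc m). \<exists>t. (x(Suc m := t)) (Suc m) = (-1) * (x(Suc m := t)) m
      \<and> (x(Suc m := t))(m := (x(Suc m := t)) (Suc m), Suc m := 0) \<in> A} \<in> S (Suc m)"
    by (intro definable_Collect_ex definable_Collect_conj upd definable_Collect_coord_eq) auto
  then show "{x \<in> rspace (Suc m). x(m := - x m) \<in> A} \<in> S (Suc m)"
    by (simp add: eq cong: conj_cong)
qed

section \<open>Definability of functions and sets obtained from a graph\<close>

lemma definable_fun_uminus:
  assumes "definable_fun S n X f"
  shows "definable_fun S n X (\<lambda>x. - f x)"
proof -
  let ?G = "{x(n := f x) | x. x \<in> X}"
  have X: "X \<subseteq> rspace n" and G: "?G \<in> S (Suc n)"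
    using assms by (auto simp: definable_fun_def)
  have "{x(n := - f x) | x. x \<in> X} = {z \<in> rspace (Suc n). z(n := - z n) \<in> ?G}"
  proof (intro equalityI subsetI)
    fix z assume "z \<in> {x(n := - f x) | x. x \<in> X}"
    then obtain x where x: "x \<in> X" "z = x(n := - f x)" by blast
    then have "z(n := - z n) = x(n := f x)" by auto
    then show "z \<in> {z \<in> rspace (Suc n). z(n := - z n) \<in> ?G}"
      using x X by (fastforce simp: topspace_Euclidean_space)
  next
    fix z assume "z \<in> {z \<in> rspace (Suc n). z(n := - z n) \<in> ?G}"
    then obtain x where x: "x \<in> X" "z(n := - z n) = x(n := f x)" by blast
    have "z = z(n := - z n, n := - (z(n := - z n)) n)" by simp
    also have "\<dots> = x(n := - f x)" unfolding x(2) by simp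
    finally show "z \<in> {x(n := - f x) | x. x \<in> X}" using x(1) by blast
  qed
  then show ?thesis
    using definable_Collect_change_last(3)[OF G] X by (simp add: definable_fun_def)
qed

text \<open>The graph is cut by the slab of values in \<open>I\<close>, and the value coordinate is
  projected away.\<close>

lemma definable_fun_Collect_interval:
  assumes "definable_fun S n X f" "is_interval I"
  shows "{x \<in> X. f x \<in> I} \<in> S n"
proof -
  let ?G = "{x(n := f x) | x. x \<in> X}"
  have X: "X \<subseteq> rspace n" and G: "?G \<in> S (Suc n)"
    using assms by (auto simp: definable_fun_def)
  have "(\<lambda>x. x(n := 0)) ` (?G \<inter> {x \<in> rspace (Suc n). x n \<in> I}) \<in> S n"
    using assms(2) by (intro definable_proj definable_Int G definable_Collect_coord_interval) auto
  moreover have "(\<lambda>x. x(n := 0)) ` (?G \<inter> {x \<in> rspace (Suc n). x n \<in> I}) = {x \<in> X. f x \<in> I}"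
  proof (intro equalityI subsetI)
    fix z assume "z \<in> (\<lambda>x. x(n := 0)) ` (?G \<inter> {x \<in> rspace (Suc n). x n \<in> I})"
    then obtain x where x: "x \<in> X" "f x \<in> I" "z = x(n := f x, n := 0)" by auto
    moreover have "x(n := f x, n := 0) = x" using x(1) X by (auto simp: topspace_Euclidean_space fun_eq_iff)
    ultimately show "z \<in> {x \<in> X. f x \<in> I}" by simp
  next
    fix x assume x: "x \<in> {x \<in> X. f x \<in> I}"
    then have "x \<in> rspace n" using X by auto
    then have "x = x(n := f x, n := 0)" "x(n := f x) \<in> rspace (Suc n)"
      by (auto simp: topspace_Euclidean_space fun_eq_iff)
    then show "x \<in> (\<lambda>x. x(n := 0)) ` (?G \<inter> {x \<in> rspace (Suc n). x n \<in> I})"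
      using x by (intro image_eqI[of _ _ "x(n := f x)"]) auto
  qed
  ultimately show ?thesis by simp
qed

text \<open>Meant for graphs over \<open>(m + 1)\<close>-space, where index \<open>m\<close> holds
  the last argument and \<open>Suc m\<close> the value. Only the last coordinate can be projected
  away, so the two are transposed first.\<close>

lemma definable_drop_penultimate:
  assumes "A \<in> S (Suc (Suc m))"
  shows "{z \<in> rspace (Suc m). \<exists>t. z(m := t, Suc m := z m) \<in> A} \<in> S (Suc m)"
proof -
  have "{x \<in> rspace (Suc (Suc m)).
      (\<lambda>i. if i < Suc (Suc m) then x (if i = m then Suc m else if i = Suc m then m else i) else 0) \<in> A}
      \<in> S (Suc (Suc m))"
    by (rule definable_Collect_reindex[OF assms]) auto
  from definable_Collect_ex[OF this] show ?thesis
  proof (rule back_subst[where P = "\<lambda>A. A \<in> S (Suc m)"], intro Collect_cong conj_cong refl ex_cong1)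
    fix z :: "nat \<Rightarrow> real" and t assume "z \<in> rspace (Suc m)"
    then have "(\<lambda>i. if i < Suc (Suc m) then (z(Suc m := t)) (if i = m then Suc m else if i = Suc m then m else i) else 0)
      = z(m := t, Suc m := z m)"
      by (auto simp: topspace_Euclidean_space fun_eq_iff)
    then show "((\<lambda>i. if i < Suc (Suc m) then (z(Suc m := t)) (if i = m then Suc m else if i = Suc m then m else i) else 0) \<in> A)
      = (z(m := t, Suc m := z m) \<in> A)" by simp
  qed
qed

text \<open>Over \<open>D\<close>, the set \<open>U\<close> is the region strictly above the
  infimum. A point lies in \<open>L\<close> iff some larger value is at most the infimum, that is,
  iff it lies strictly below. The graph is what remains of the cylinder \<open>K\<close> over
  \<open>D\<close> after removing both.\<close>

lemma definable_fun_Inf_fibres: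
  assumes H: "H \<in> S (Suc m)"
    and D: "D = (\<lambda>x. x(m := 0)) ` H"
    and bdd: "\<And>x. x \<in> D \<Longrightarrow> bdd_below {y. x(m := y) \<in> H}"
  shows "definable_fun S m D (\<lambda>x. Inf {y. x(m := y) \<in> H})"
proof -
  let ?g = "\<lambda>x. Inf {y. x(m := y) \<in> H}"
  define U where "U = {x \<in> rspace (Suc m). \<exists>t < x m. x(m := t) \<in> H}"
  define L where "L = {x \<in> rspace (Suc m). \<exists>t > x m. x(m := t) \<in> rspace (Suc m) - U}"
  define K where "K = {x \<in> rspace (Suc m). (\<lambda>i. if i < m then x i else 0) \<in> D}"
  have DS: "D \<in> S m" unfolding D using H by (rule definable_proj)
  then have Dr: "D \<subseteq> rspace m" by (rule definable_subset)
  have U: "U \<in> S (Suc m)" unfolding U_def by (rule definable_Collect_change_last[OF H])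
  have L: "L \<in> S (Suc m)"
    unfolding L_def by (rule definable_Collect_change_last[OF definable_compl[OF U]])
  have K: "K \<in> S (Suc m)"
    unfolding K_def by (rule definable_Collect_reindex[OF DS]) auto
  have in_r: "x(m := s) \<in> rspace (Suc m)" if "x \<in> D" for x s
    using that Dr by (auto simp: topspace_Euclidean_space subset_iff)
  have ne: "{y. x(m := y) \<in> H} \<noteq> {}" if "x \<in> D" for x
  proof -
    from that obtain z where "z \<in> H" "x = z(m := 0)" unfolding D by blast
    then have "x(m := z m) \<in> H" by simp
    then show ?thesis by blast
  qed
  have inU: "x(m := s) \<in> U \<longleftrightarrow> ?g x < s" if "x \<in> D" for x s
    using in_r[OF that] cInf_less_iff[OF ne[OF that] bdd[OF that], of s]
    by (auto simp: U_def)
  have inL: "x(m := s) \<in> L \<longleftrightarrow> s < ?g x" if "x \<in> D" for x s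
  proof -
    have "x(m := s) \<in> L \<longleftrightarrow> (\<exists>t>s. t \<le> ?g x)"
      using in_r[OF that] inU[OF that] by (auto simp: L_def not_less)
    then show ?thesis by auto
  qed
  have "{x(m := ?g x) | x. x \<in> D} = K \<inter> (rspace (Suc m) - U) \<inter> (rspace (Suc m) - L)"
  proof (intro equalityI subsetI)
    fix z assume "z \<in> {x(m := ?g x) | x. x \<in> D}"
    then obtain x where x: "x \<in> D" "z = x(m := ?g x)" by blast
    have "(\<lambda>i. if i < m then z i else 0) = x"
      using x Dr by (auto simp: topspace_Euclidean_space fun_eq_iff subset_iff)
    moreover have "z \<in> rspace (Suc m)" using x in_r by simp
    ultimately have "z \<in> K" using x(1) by (simp add: K_def)
    then show "z \<in> K \<inter> (rspace (Suc m) - U) \<inter> (rspace (Suc m) - L)"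
      using inU[OF x(1), of "?g x"] inL[OF x(1), of "?g x"] in_r[OF x(1)] x(2) by auto
  next
    fix z assume z: "z \<in> K \<inter> (rspace (Suc m) - U) \<inter> (rspace (Suc m) - L)"
    define x where "x = (\<lambda>i. if i < m then z i else 0)"
    have x: "x \<in> D" using z by (auto simp: K_def x_def)
    have "z = x(m := z m)"
      using z by (auto simp: x_def topspace_Euclidean_space fun_eq_iff)
    moreover from this have "z m = ?g x"
      using z inU[OF x, of "z m"] inL[OF x, of "z m"] by auto
    ultimately show "z \<in> {x(m := ?g x) | x. x \<in> D}" using x by (metis (mono_tags, lifting) mem_Collect_eq)
  qed
  moreover have "K \<inter> (rspace (Suc m) - U) \<inter> (rspace (Suc m) - L) \<in> S (Suc m)"
    by (intro definable_Int definable_compl K U L)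
  ultimately show ?thesis using Dr by (simp add: definable_fun_def)
qed

end

section \<open>Connectedness on one side of a wall\<close>

text \<open>Both this and the next fact identify \<open>n\<close>-space with a subspace of the
  function type under its product topology, so that the type-class notions of open and connected
  sets apply.\<close>

lemma openin_Euclidean_space:
  "openin (Euclidean_space n) X \<longleftrightarrow> openin (top_of_set (rspace n)) X"
  unfolding topspace_Euclidean_space by (simp add: Euclidean_space_def euclidean_product_topology)

lemma connectedin_Euclidean_space:
  "connectedin (Euclidean_space n) X \<longleftrightarrow> connected X \<and> X \<subseteq> rspace n"
  unfolding topspace_Euclidean_space
  by (simp add: Euclidean_space_def euclidean_product_topology connectedin_subtopology)

lemma continuous_on_fun_upd_const:
  fixes t :: real shows "continuous_on A (\<lambda>x. x(m := t))"
proof (rule continuous_on_coordinatewise_then_product)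
  fix i
  have "continuous_on A (\<lambda>x :: 'a \<Rightarrow> real. x i)"
    by (rule continuous_on_subset[OF continuous_on_product_coordinates subset_UNIV])
  then show "continuous_on A (\<lambda>x :: 'a \<Rightarrow> real. (x(m := t)) i)"
    by (cases "i = m") (simp_all add: fun_upd_def)
qed

text \<open>Each factor of a basic box is shrunk to the component of the point's coordinate.
  Components of open sets of reals are open, and a factor \<open>UNIV\<close> stays
  \<open>UNIV\<close>, so still only finitely many factors are restricted and the box stays
  open.\<close>

lemma open_contains_connected_box:
  fixes p :: "'i \<Rightarrow> real"
  assumes "open T" "p \<in> T"
  obtains X where "p \<in> PiE UNIV X" "open (PiE UNIV X)" "\<And>i. open (X i)" "\<And>i. connected (X i)"
    "PiE UNIV X \<subseteq> T"
proof -
  have "openin (product_topology (\<lambda>i. euclidean) UNIV) T"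
    using assms(1) by (simp add: euclidean_product_topology)
  from product_topology_open_contains_basis[OF this assms(2)]
  have "\<exists>X. p \<in> PiE UNIV X \<and> (\<forall>i. open (X i)) \<and> finite {i. X i \<noteq> UNIV} \<and> PiE UNIV X \<subseteq> T"
    by simp
  then obtain X where X: "p \<in> PiE UNIV X" "\<And>i. open (X i)" "finite {i. X i \<noteq> UNIV}" "PiE UNIV X \<subseteq> T"
    by (elim exE conjE) (rule that, assumption, erule spec, assumption+)
  define X' where "X' i = connected_component_set (X i) (p i)" for i
  have sub: "X' i \<subseteq> X i" for i unfolding X'_def by (rule connected_component_subset)
  have op: "open (X' i)" for i unfolding X'_def using X(2) by (rule open_connected_component)
  have "X' i = UNIV" if "X i = UNIV" for i
    using that by (simp add: X'_def connected_component_UNIV)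
  then have "finite {i. X' i \<noteq> UNIV}"
    by (intro finite_subset[OF _ X(3)]) auto
  then have box: "open (PiE UNIV X')" by (intro open_PiE op)
  have p: "p \<in> PiE UNIV X'" using X(1) by (auto simp: X'_def connected_component_refl)
  have conn: "connected (X' i)" for i by (simp add: X'_def)
  have "PiE UNIV X' \<subseteq> T" by (rule subset_trans[OF PiE_mono[OF sub] X(4)])
  from that[OF p box op conn this] show ?thesis .
qed

text \<open>If \<open>U\<close>, \<open>V\<close> separate the part of \<open>Y\<close> over \<open>H\<close>, a small box around a point of the wall
  \<open>z j = c\<close> meets that part in a box, so it sees only one of \<open>U\<close>, \<open>V\<close>.  As the wall is
  connected, one of the two does not accumulate at it and is therefore clopen in \<open>Y\<close>.\<close>

lemma connected_one_side:
  fixes Y :: "('i \<Rightarrow> real) set"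
  assumes I: "\<And>i. connected (I i)" "I j = UNIV"
    and Y: "openin (top_of_set (PiE UNIV I)) Y" "connected Y"
    and wall: "connected (Y \<inter> {z. z j = c})"
    and H: "connected H" "open H" "closure H = insert c H" "c \<notin> H"
  shows "connected (Y \<inter> {z. z j \<in> H})" (is "connected ?Z")
proof (rule ccontr)
  let ?A = "Y \<inter> {z. z j = c}"
  assume "\<not> connected ?Z"
  then obtain U V where UV: "openin (top_of_set ?Z) U" "openin (top_of_set ?Z) V"
      "?Z = U \<union> V" "U \<inter> V = {}" "U \<noteq> {}" "V \<noteq> {}"
    unfolding connected_openin_eq by metis
  obtain T where T: "open T" "Y = PiE UNIV I \<inter> T"
    using Y(1) by (auto simp: openin_open)
  have coord: "open ((\<lambda>z :: 'i \<Rightarrow> real. z j) -` K)" if "open K" for K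
    using that continuous_on_product_coordinates by (rule open_vimage)
  have ZY: "openin (top_of_set Y) ?Z"
    using coord[OF H(2)] by (auto simp: openin_open vimage_def)
  have sees_one: "\<not> (p \<in> closure U \<and> p \<in> closure V)" and limit: "p \<in> closure ?Z"
    if p: "p \<in> ?A" for p
  proof -
    have nbhd: "\<exists>N. open N \<and> p \<in> N \<and> N \<subseteq> W \<and> connected (N \<inter> ?Z) \<and> N \<inter> ?Z \<noteq> {}"
      if "open W" "p \<in> W" for W
    proof -
      have "open (T \<inter> W)" "p \<in> T \<inter> W" using T p that by auto
      then obtain X where X: "p \<in> PiE UNIV X" "open (PiE UNIV X)" "\<And>i. open (X i)"
          "\<And>i. connected (X i)" "PiE UNIV X \<subseteq> T \<inter> W"
        using open_contains_connected_box by blast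
      \<comment> \<open>Since the box \<open>PiE UNIV X\<close> lies in \<open>T\<close>, membership
        in \<open>Y\<close> inside it is decided by the factors \<open>I i\<close>, and the side of
        the wall by the factor \<open>H\<close> at index \<open>j\<close>. Hence it meets
        \<open>?Z\<close> in a product of intervals.\<close>
      define K where "K i = X i \<inter> I i \<inter> (if i = j then H else UNIV)" for i
      have eq: "PiE UNIV X \<inter> ?Z = PiE UNIV K"
        using X(5) unfolding T(2) K_def by (auto simp: PiE_iff split: if_splits)
      have "is_interval (X i)" "is_interval (I i)" "is_interval H" for i
        using X(4) I(1) H(1) by (simp_all add: is_interval_connected_1)
      then have "is_interval (K i)" for i
        unfolding K_def by (simp add: is_interval_Int)
      then have "connected (K i)" for i
        by (simp add: is_interval_connected_1)
      then have "connectedin (product_topology (\<lambda>i. euclideanreal) UNIV) (PiE UNIV K)"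
        by (simp add: connectedin_PiE)
      then have "connected (PiE UNIV K)"
        by (simp add: euclidean_product_topology)
      \<comment> \<open>The product is non-empty: \<open>c\<close> is in the closure of
        \<open>H\<close>, so \<open>p j = c\<close> can be replaced by some \<open>t\<close> in
        \<open>X j\<close> and \<open>H\<close>. The new point stays in the ambient product because
        \<open>I j = UNIV\<close>.\<close>
      moreover have "X j \<inter> H \<noteq> {}"
      proof -
        have "c \<in> X j" using X(1) p by auto
        then show ?thesis using H(3) open_Int_closure_eq_empty[OF X(3), of j H] by blast
      qed
      then obtain t where t: "t \<in> X j" "t \<in> H" by blast
      have "p(j := t) \<in> PiE UNIV K"
        using t X(1) p T(2) I(2) by (auto simp: K_def PiE_iff)
      ultimately have "connected (PiE UNIV X \<inter> ?Z)" "PiE UNIV X \<inter> ?Z \<noteq> {}"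
        unfolding eq by blast+
      then show ?thesis using X(1,2,5) by blast
    qed
    show "\<not> (p \<in> closure U \<and> p \<in> closure V)"
    proof
      assume cl: "p \<in> closure U \<and> p \<in> closure V"
      obtain N where N: "open N" "p \<in> N" "connected (N \<inter> ?Z)"
        using nbhd[of UNIV] by auto
      have "N \<inter> U \<noteq> {}" "N \<inter> V \<noteq> {}"
        using cl N(1,2) closure_iff_nhds_not_empty[of p] by blast+
      moreover have "openin (top_of_set (N \<inter> ?Z)) (N \<inter> U)" "openin (top_of_set (N \<inter> ?Z)) (N \<inter> V)"
        using UV(1,2) by (auto simp: openin_open)
      moreover have "(N \<inter> U) \<union> (N \<inter> V) = N \<inter> ?Z" "(N \<inter> U) \<inter> (N \<inter> V) = {}"
        using UV(3,4) by auto
      ultimately show False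
        using N(3) unfolding connected_openin_eq by blast
    qed
    show "p \<in> closure ?Z"
      unfolding closure_iff_nhds_not_empty
      using nbhd by blast
  qed
  \<comment> \<open>Limits of \<open>W\<close> have their \<open>j\<close>-th coordinate in
    \<open>insert c H\<close>. With the value \<open>c\<close> excluded inside \<open>Y\<close>,
    they remain in \<open>?Z\<close>, where \<open>W\<close> is closed; so \<open>W\<close> is
    closed in \<open>Y\<close>, and it is open there since \<open>?Z\<close> is.\<close>
  have clopen: "W = {} \<or> W = Y"
    if W: "openin (top_of_set ?Z) W" "closedin (top_of_set ?Z) W" "?A \<inter> closure W = {}" for W
  proof -
    have "W \<subseteq> ?Z" using W(1) by (rule openin_imp_subset)
    then have "W \<subseteq> (\<lambda>z. z j) -` closure H" using closure_subset by blast
    moreover have "closed ((\<lambda>z :: 'i \<Rightarrow> real. z j) -` closure H)"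
      by (intro closed_vimage continuous_on_product_coordinates closed_closure)
    ultimately have "closure W \<subseteq> (\<lambda>z. z j) -` closure H" by (rule closure_minimal)
    then have "Y \<inter> closure W \<subseteq> ?Z" using W(3) H(3) by auto
    moreover obtain K where K: "closed K" "W = ?Z \<inter> K"
      using W(2) by (auto simp: closedin_closed)
    then have "closure W \<subseteq> K" by (metis closure_minimal inf_le2)
    ultimately have "W = Y \<inter> closure W" using K closure_subset[of W] by blast
    then have "closedin (top_of_set Y) W" by (metis closedin_closed_Int closed_closure)
    moreover have "openin (top_of_set Y) W" using W(1) ZY by (rule openin_trans)
    ultimately show ?thesis using Y(2) unfolding connected_clopen by blast
  qed
  have "U = ?Z - V" "V = ?Z - U" using UV(3,4) by auto
  then have cl: "closedin (top_of_set ?Z) U" "closedin (top_of_set ?Z) V"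
    using closedin_diff[OF closedin_topspace UV(1)] closedin_diff[OF closedin_topspace UV(2)] by simp_all
  \<comment> \<open>If the closure of \<open>U\<close> missed the wall, \<open>U\<close> would be
    all of \<open>Y\<close> and leave no room for \<open>V\<close>; symmetrically for
    \<open>V\<close>. The two closures therefore split the wall into disjoint non-empty relatively
    closed pieces.\<close>
  have "?A \<inter> closure U \<noteq> {}"
    using clopen[OF UV(1) cl(1)] UV by blast
  moreover have "?A \<inter> closure V \<noteq> {}"
    using clopen[OF UV(2) cl(2)] UV by blast
  moreover have "?A \<subseteq> closure U \<union> closure V"
    using limit UV(3) by (auto simp flip: closure_Un)
  moreover have "?A \<inter> closure U \<inter> closure V = {}" using sees_one by blast
  ultimately show False
    using wall closed_closure[of U] closed_closure[of V] unfolding connected_closed by blast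
qed

section \<open>Coordinate cones, projections and slices\<close>

text \<open>A cone constrains its coordinates independently, each to a ray, a point or the whole
  line. The factors \<open>{0}\<close> encode that points of \<open>m\<close>-space vanish from
  index \<open>m\<close> on.\<close>

lemma coordinate_cone_box:
  assumes "coordinate_cone m C"
  shows "\<exists>I. (\<forall>i. connected (I i)) \<and> (\<forall>i\<ge>m. I i = {0}) \<and> C = PiE UNIV I"
proof -
  obtain J \<sigma> c where J: "J \<subseteq> {..<m}" "\<forall>j\<in>J. \<sigma> j \<in> {(<), (=), (>)}"
      "C = {z \<in> rspace m. \<forall>j\<in>J. \<sigma> j (z j) (c j :: real)}"
    using assms by (auto simp: coordinate_cone_def)
  define I where "I i = (if i \<in> J then {t. \<sigma> i t (c i)} else if i < m then UNIV else {0})" for i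
  have "connected (I i)" for i
  proof (cases "i \<in> J")
    case True
    then have "I i = {..<c i} \<or> I i = {c i} \<or> I i = {c i<..}" using J(2) by (auto simp: I_def)
    then show ?thesis by (metis connected_Iio connected_Ioi connected_sing)
  qed (auto simp: I_def)
  moreover have "I i = {0}" if "i \<ge> m" for i using that J(1) by (auto simp: I_def)
  moreover have "C = PiE UNIV I"
  proof (rule set_eqI)
    fix z
    have "z \<in> C \<longleftrightarrow> (\<forall>i. (i \<ge> m \<longrightarrow> z i = 0) \<and> (i \<in> J \<longrightarrow> \<sigma> i (z i) (c i)))"
      by (auto simp: J(3) topspace_Euclidean_space)
    also have "\<dots> \<longleftrightarrow> (\<forall>i. z i \<in> I i)"
      using J(1) by (intro iff_allI) (auto simp: I_def)
    finally show "z \<in> C \<longleftrightarrow> z \<in> PiE UNIV I" by (auto simp: PiE_iff)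
  qed
  ultimately show ?thesis by blast
qed

abbreviation cylinder :: "nat \<Rightarrow> (nat \<Rightarrow> real) set \<Rightarrow> (nat \<Rightarrow> real) set" where
  "cylinder m D \<equiv> {z \<in> rspace (Suc m). z(m := 0) \<in> D}"

text \<open>The same constraints are read one dimension higher, in the second case with the equation
  at index \<open>m\<close> added.\<close>

lemma coordinate_cone_cylinder:
  assumes "coordinate_cone m C"
  shows "coordinate_cone (Suc m) (cylinder m C)"
    and "coordinate_cone (Suc m) (cylinder m C \<inter> {z. z m = a})"
proof -
  obtain J \<sigma> c where J: "J \<subseteq> {..<m}" "\<forall>j\<in>J. \<sigma> j \<in> {(<), (=), (>)}"
      "C = {z \<in> rspace m. \<forall>j\<in>J. \<sigma> j (z j) (c j :: real)}"
    using assms by (auto simp: coordinate_cone_def)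
  have cyl: "cylinder m C = {z \<in> rspace (Suc m). \<forall>j\<in>J. \<sigma> j (z j) (c j)}"
    using J(1) unfolding J(3) by (auto simp: topspace_Euclidean_space Suc_le_eq)
  then show "coordinate_cone (Suc m) (cylinder m C)"
    unfolding coordinate_cone_def using J(1,2) by (intro exI[of _ J] exI[of _ \<sigma>] exI[of _ c]) auto
  have "cylinder m C \<inter> {z. z m = a} = {z \<in> rspace (Suc m). \<forall>j\<in>insert m J. (\<sigma>(m := (=))) j (z j) ((c(m := a)) j)}"
    unfolding cyl using J(1) by auto
  then show "coordinate_cone (Suc m) (cylinder m C \<inter> {z. z m = a})"
    unfolding coordinate_cone_def using J(1,2)
    by (intro exI[of _ "insert m J"] exI[of _ "\<sigma>(m := (=))"] exI[of _ "c(m := a)"]) auto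
qed

text \<open>Splits by the constraint on the last coordinate: none, an equation, or a strict
  inequality.\<close>

lemma coordinate_cone_SucE:
  assumes "coordinate_cone (Suc m) C"
  obtains C' where "coordinate_cone m C'" "C = cylinder m C'"
  | C' a where "coordinate_cone m C'" "C = cylinder m C' \<inter> {z. z m = a}"
  | C' H a where "coordinate_cone m C'" "C = cylinder m C' \<inter> {z. z m \<in> H}" "H = {..<a} \<or> H = {a<..}"
proof -
  obtain J \<sigma> c where J: "J \<subseteq> {..<Suc m}" "\<forall>j\<in>J. \<sigma> j \<in> {(<), (=), (>)}"
      "C = {z \<in> rspace (Suc m). \<forall>j\<in>J. \<sigma> j (z j) (c j :: real)}"
    using assms by (auto simp: coordinate_cone_def)
  define C' where "C' = {z \<in> rspace m. \<forall>j\<in>J - {m}. \<sigma> j (z j) (c j)}"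
  have cone: "coordinate_cone m C'"
    unfolding C'_def coordinate_cone_def using J(1,2)
    by (intro exI[of _ "J - {m}"] exI[of _ \<sigma>] exI[of _ c]) (auto simp: less_Suc_eq)
  have cyl: "cylinder m C' = {z \<in> rspace (Suc m). \<forall>j\<in>J - {m}. \<sigma> j (z j) (c j)}"
    by (auto simp: C'_def topspace_Euclidean_space Suc_le_eq)
  show ?thesis
  proof (cases "m \<in> J")
    case False
    then show ?thesis using cone that(1) cyl J(3) by simp
  next
    case True
    then have C: "C = cylinder m C' \<inter> {z. \<sigma> m (z m) (c m)}"
      unfolding cyl J(3) by auto
    from True J(2) consider "\<sigma> m = (<)" | "\<sigma> m = (=)" | "\<sigma> m = (>)" by auto
    then show ?thesis
    proof cases
      case 1
      then show ?thesis using C cone by (intro that(3)[of C' "{..<c m}"]) auto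
    next
      case 2
      then show ?thesis using C cone by (intro that(2)) auto
    next
      case 3
      then show ?thesis using C cone by (intro that(3)[of C' "{c m<..}"]) auto
    qed
  qed
qed

lemma coordinate_cone_subset: "coordinate_cone n C \<Longrightarrow> C \<subseteq> rspace n"
  unfolding coordinate_cone_def by blast

lemma semi_monotone_iff:
  "semi_monotone S n X \<longleftrightarrow> openin (top_of_set (rspace n)) X \<and> bounded_in n X \<and> X \<in> S n \<and>
     (\<forall>C. coordinate_cone n C \<longrightarrow> connected (X \<inter> C))"
  unfolding semi_monotone_def openin_Euclidean_space connectedin_Euclidean_space
  using coordinate_cone_subset by blast

lemma fun_upd_in_rspace [simp]: "x \<in> rspace m \<Longrightarrow> x(m := t) \<in> rspace (Suc m)"
  by (auto simp: topspace_Euclidean_space)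

lemma fun_upd_last_zero [simp]: "x \<in> rspace m \<Longrightarrow> x(m := 0) = x"
  by (auto simp: topspace_Euclidean_space fun_eq_iff)

lemma fun_upd_zero_in_rspace [simp]: "x \<in> rspace (Suc m) \<Longrightarrow> x(m := 0) \<in> rspace m"
  by (auto simp: topspace_Euclidean_space Suc_le_eq)

lemma slice_last_Suc [simp]: "slice_last (Suc m) X a = {x \<in> rspace m. x(m := a) \<in> X}"
  by (simp add: slice_last_def)

lemma proj_last_Suc:
  assumes "X \<subseteq> rspace (Suc m)"
  shows "proj_last (Suc m) X = {x \<in> rspace m. \<exists>t. x(m := t) \<in> X}"
proof (intro equalityI subsetI)
  fix x assume "x \<in> proj_last (Suc m) X"
  then obtain z where "z \<in> X" "x = z(m := 0)" by (auto simp: proj_last_def)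
  then show "x \<in> {x \<in> rspace m. \<exists>t. x(m := t) \<in> X}"
    using assms by (auto intro!: exI[of _ "z m"])
next
  fix x assume "x \<in> {x \<in> rspace m. \<exists>t. x(m := t) \<in> X}"
  then obtain t where "x(m := t) \<in> X" "x = (x(m := t))(m := 0)" by auto
  then show "x \<in> proj_last (Suc m) X"
    unfolding proj_last_def diff_Suc_1 by (intro image_eqI[of _ _ "x(m := t)"])
qed

lemma openin_slice_last:
  assumes "openin (top_of_set (rspace (Suc m))) X"
  shows "openin (top_of_set (rspace m)) (slice_last (Suc m) X a)"
proof -
  have "openin (top_of_set (rspace m)) (rspace m \<inter> (\<lambda>x. x(m := a)) -` X)"
    using assms by (intro continuous_openin_preimage[OF continuous_on_fun_upd_const]) auto
  then show ?thesis by (simp add: Int_def)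
qed

text \<open>The projection is the union of the slices, each open as a preimage under
  \<open>x \<mapsto> x(m := a)\<close>. So forgetting the last coordinate is an open map.\<close>

lemma openin_proj_last:
  assumes "openin (top_of_set (rspace (Suc m))) X"
  shows "openin (top_of_set (rspace m)) (proj_last (Suc m) X)"
proof -
  have "proj_last (Suc m) X = (\<Union>t. slice_last (Suc m) X t)"
    using proj_last_Suc[OF openin_imp_subset[OF assms]] by auto
  then show ?thesis using openin_slice_last[OF assms] by auto
qed

lemma bounded_in_subset: "bounded_in n X \<Longrightarrow> Y \<subseteq> X \<Longrightarrow> bounded_in n Y"
  unfolding bounded_in_def by blast

lemma bounded_in_proj_last:
  assumes "bounded_in (Suc m) X"
  shows "bounded_in m (proj_last (Suc m) X)"
proof -
  obtain B where B: "\<And>x. x \<in> X \<Longrightarrow> L2_set x {..<Suc m} \<le> B"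
    using assms by (auto simp: bounded_in_def)
  have "L2_set (x(m := 0)) {..<m} \<le> B" if "x \<in> X" for x
  proof -
    have "L2_set (x(m := 0)) {..<m} = L2_set x {..<m}"
      by (rule L2_set_cong) auto
    also have "\<dots> \<le> L2_set x {..<Suc m}"
      unfolding L2_set_def by (simp add: real_sqrt_le_mono)
    finally show ?thesis using B[OF that] by simp
  qed
  then show ?thesis
    unfolding bounded_in_def proj_last_def by (intro exI[of _ B]) simp
qed

lemma slice_last_subset_proj_last: "slice_last (Suc m) X a \<subseteq> proj_last (Suc m) X"
proof
  fix x assume "x \<in> slice_last (Suc m) X a"
  then have "x(m := a) \<in> X" "x = (x(m := a))(m := 0)" by auto
  then show "x \<in> proj_last (Suc m) X"
    unfolding proj_last_def diff_Suc_1 by (intro image_eqI[of _ _ "x(m := a)"])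
qed

section \<open>Projections and slices of semi-monotone sets\<close>

context o_minimal_structure
begin

lemma definable_proj_last:
  assumes "X \<in> S (Suc m)"
  shows "proj_last (Suc m) X \<in> S m"
  using definable_proj[OF assms] by (simp add: proj_last_def)

lemma definable_slice_last:
  assumes "X \<in> S (Suc m)"
  shows "slice_last (Suc m) X a \<in> S m"
proof -
  have "{x \<in> rspace (Suc m). x m \<in> {a} \<and> x \<in> X} \<in> S (Suc m)"
    by (rule definable_Collect_conj[OF definable_Collect_coord_interval definable_Collect_mem[OF assms]])
      (simp_all add: is_interval_def)
  from definable_Collect_ex[OF this] show ?thesis by simp
qed

text \<open>The part of the projection in a cone is the continuous image of the part of
  \<open>X\<close> in the cylinder over it, which is again a cone.\<close>

lemma semi_monotone_proj_last:
  assumes "semi_monotone S (Suc m) X"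
  shows "semi_monotone S m (proj_last (Suc m) X)"
proof -
  have X: "openin (top_of_set (rspace (Suc m))) X" "bounded_in (Suc m) X" "X \<in> S (Suc m)"
    "\<And>C. coordinate_cone (Suc m) C \<Longrightarrow> connected (X \<inter> C)"
    using assms unfolding semi_monotone_iff by blast+
  have "connected (proj_last (Suc m) X \<inter> C)" if "coordinate_cone m C" for C
  proof -
    have "connected ((\<lambda>x. x(m := 0)) ` (X \<inter> cylinder m C))"
      by (intro connected_continuous_image continuous_on_fun_upd_const X coordinate_cone_cylinder that)
    moreover have "(\<lambda>x. x(m := 0)) ` (X \<inter> cylinder m C) = proj_last (Suc m) X \<inter> C"
      using openin_imp_subset[OF X(1)] by (auto simp: proj_last_def)
    ultimately show ?thesis by simp
  qed
  then show ?thesis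
    unfolding semi_monotone_iff
    using openin_proj_last[OF X(1)] bounded_in_proj_last[OF X(2)] definable_proj_last[OF X(3)] by blast
qed

text \<open>As for projections, with the cone \<open>cylinder m C\<close> cut further by the
  equation \<open>z m = a\<close>.\<close>

lemma semi_monotone_slice_last:
  assumes "semi_monotone S (Suc m) X"
  shows "semi_monotone S m (slice_last (Suc m) X a)"
proof -
  have X: "openin (top_of_set (rspace (Suc m))) X" "bounded_in (Suc m) X" "X \<in> S (Suc m)"
    "\<And>C. coordinate_cone (Suc m) C \<Longrightarrow> connected (X \<inter> C)"
    using assms unfolding semi_monotone_iff by blast+
  have "connected (slice_last (Suc m) X a \<inter> C)" if "coordinate_cone m C" for C
  proof -
    have "connected ((\<lambda>x. x(m := 0)) ` (X \<inter> (cylinder m C \<inter> {z. z m = a})))"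
      by (intro connected_continuous_image continuous_on_fun_upd_const X coordinate_cone_cylinder that)
    moreover have "(\<lambda>x. x(m := 0)) ` (X \<inter> (cylinder m C \<inter> {z. z m = a})) = slice_last (Suc m) X a \<inter> C"
    proof (intro equalityI subsetI)
      fix x assume "x \<in> (\<lambda>x. x(m := 0)) ` (X \<inter> (cylinder m C \<inter> {z. z m = a}))"
      then show "x \<in> slice_last (Suc m) X a \<inter> C" by auto
    next
      fix x assume "x \<in> slice_last (Suc m) X a \<inter> C"
      then show "x \<in> (\<lambda>x. x(m := 0)) ` (X \<inter> (cylinder m C \<inter> {z. z m = a}))"
        by (intro image_eqI[of _ _ "x(m := a)"]) auto
    qed
    ultimately show ?thesis by simp
  qed
  moreover have "bounded_in m (slice_last (Suc m) X a)"
    using bounded_in_proj_last[OF X(2)] slice_last_subset_proj_last by (rule bounded_in_subset)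
  ultimately show ?thesis
    unfolding semi_monotone_iff
    using openin_slice_last[OF X(1)] definable_slice_last[OF X(3)] by blast
qed

end

section \<open>Semi-monotone sets and submonotone functions\<close>

lemma continuous_on_fun_upd_value:
  fixes y :: "'a \<Rightarrow> real" shows "continuous_on A (\<lambda>t. y(m := t))"
proof (rule continuous_on_coordinatewise_then_product)
  show "continuous_on A (\<lambda>t. (y(m := t)) i)" for i
    by (cases "i = m") (simp_all add: continuous_on_id)
qed

text \<open>Frees the factor at \<open>m\<close> in the box of the cone, which provides the
  hypothesis \<open>I j = UNIV\<close> of \<open>connected_one_side\<close>.\<close>

lemma cylinder_box:
  assumes "coordinate_cone m C"
  shows "\<exists>I. (\<forall>i. connected (I i)) \<and> I m = UNIV \<and> cylinder m C = PiE UNIV I"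
proof -
  obtain I where I: "\<forall>i. connected (I i)" "\<forall>i\<ge>m. I i = {0}" "C = PiE UNIV I"
    using coordinate_cone_box[OF assms] by blast
  have "cylinder m C = PiE UNIV (I(m := UNIV))"
  proof (rule set_eqI)
    fix z :: "nat \<Rightarrow> real"
    have "z \<in> cylinder m C \<longleftrightarrow> z \<in> rspace (Suc m) \<and> (\<forall>i. (z(m := 0)) i \<in> I i)"
      by (simp add: I(3) PiE_iff)
    also have "\<dots> \<longleftrightarrow> (\<forall>i. z i \<in> (I(m := UNIV)) i)"
    proof (intro iffI allI conjI)
      fix i assume z: "z \<in> rspace (Suc m) \<and> (\<forall>i. (z(m := 0)) i \<in> I i)"
      then have "(z(m := 0)) i \<in> I i" by blast
      then show "z i \<in> (I(m := UNIV)) i" by (simp split: if_splits)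
    next
      assume z: "\<forall>i. z i \<in> (I(m := UNIV)) i"
      show "z \<in> rspace (Suc m)"
        unfolding topspace_Euclidean_space
      proof (intro CollectI allI impI)
        fix i assume "Suc m \<le> i"
        then have "i \<noteq> m" "I i = {0}" using I(2) by simp_all
        then show "z i = 0" using z[rule_format, of i] by simp
      qed
      fix i
      show "(z(m := 0)) i \<in> I i"
        using z[rule_format, of i] I(2)[rule_format, of m] by (cases "i = m") simp_all
    qed
    finally show "z \<in> cylinder m C \<longleftrightarrow> z \<in> PiE UNIV (I(m := UNIV))" by (simp add: PiE_iff)
  qed
  moreover have "\<forall>i. connected ((I(m := UNIV)) i)" using I(1) by simp
  ultimately show ?thesis by (intro exI[of _ "I(m := UNIV)"]) simp
qed

lemma open_bounded_connected_real:
  fixes A :: "real set"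
  assumes "open A" "connected A" "bounded A" "A \<noteq> {}"
  shows "\<exists>a b. a < b \<and> A = {a<..<b}"
proof -
  have bdd: "bdd_below A" "bdd_above A"
    using assms(3) by (auto intro: bounded_imp_bdd_below bounded_imp_bdd_above)
  have "A = {Inf A<..<Sup A}"
  proof (intro equalityI subsetI)
    fix t assume t: "t \<in> A"
    then obtain e where e: "e > 0" "\<And>s. dist s t < e \<Longrightarrow> s \<in> A"
      using assms(1) unfolding open_dist by metis
    have "t - e/2 \<in> A" "t + e/2 \<in> A" using e by (auto simp: dist_real_def)
    then have "Inf A \<le> t - e/2" "t + e/2 \<le> Sup A"
      using bdd by (auto intro: cInf_lower cSup_upper)
    then show "t \<in> {Inf A<..<Sup A}" using e(1) by auto
  next
    fix t assume t: "t \<in> {Inf A<..<Sup A}"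
    obtain s where "s \<in> A" "s < t" using t cInf_lessD[of A t] assms(4) by auto
    moreover obtain s' where "s' \<in> A" "t < s'" using t less_cSupD[of A t] assms(4) by auto
    ultimately show "t \<in> A"
      using connectedD_interval[OF assms(2), of s s' t] by simp
  qed
  moreover from this have "Inf A < Sup A" using assms(4) by force
  ultimately show ?thesis by blast
qed

text \<open>At a level above a bound of \<open>f\<close> the sublevel set is all of
  \<open>X\<close>, which makes \<open>X\<close> semi-monotone; upper semicontinuity is the openness
  of the sublevel sets.\<close>

lemma submonotone_iff:
  "submonotone S n X f \<longleftrightarrow> X \<noteq> {} \<and> definable_fun S n X f \<and> bounded (f ` X) \<and>
     (\<forall>b. semi_monotone S n {x \<in> X. f x < b})" (is "_ \<longleftrightarrow> ?R")
proof
  assume R: ?R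
  then obtain B where "\<forall>x\<in>X. norm (f x) \<le> B" unfolding bounded_iff by auto
  then have "{x \<in> X. f x < B + 1} = X" by force
  then have "semi_monotone S n X" using R by metis
  moreover have "upper_semicontinuous n X f"
    unfolding upper_semicontinuous_def
  proof (intro ballI allI impI)
    fix x b assume "x \<in> X" "f x < b"
    then show "\<exists>U. openin (Euclidean_space n) U \<and> x \<in> U \<and> (\<forall>y\<in>U \<inter> X. f y < b)"
      using R unfolding semi_monotone_def by (intro exI[of _ "{x \<in> X. f x < b}"]) simp
  qed
  ultimately show "submonotone S n X f" using R unfolding submonotone_def by blast
qed (auto simp: submonotone_def)

text \<open>An identity of total functions, since \<open>Inf\<close> on the reals is by definition
  the negated \<open>Sup\<close> of the negated set. It carries results on infima over to
  suprema.\<close>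

lemma sup_last_conv_inf_last: "- sup_last n X f = inf_last n X (\<lambda>x. - f x)"
proof
  fix x
  have "uminus ` fibre_values n X (\<lambda>x. - f x) x = fibre_values n X f x"
    unfolding fibre_values_def by (fastforce simp: image_iff)
  then show "(- sup_last n X f) x = inf_last n X (\<lambda>x. - f x) x"
    by (simp add: inf_last_def sup_last_def Inf_real_def)
qed

lemma inf_last_less_iff:
  assumes "x \<in> proj_last (Suc m) X" "bdd_below (fibre_values (Suc m) X f x)"
    and "X \<subseteq> rspace (Suc m)"
  shows "inf_last (Suc m) X f x < b \<longleftrightarrow> (\<exists>t. x(m := t) \<in> X \<and> f (x(m := t)) < b)"
proof -
  have "fibre_values (Suc m) X f x \<noteq> {}"
    using assms(1) unfolding proj_last_Suc[OF assms(3)] fibre_values_def by auto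
  from cInf_less_iff[OF this assms(2)] show ?thesis
    unfolding inf_last_def fibre_values_def by auto
qed

text \<open>With strict inequality, an infimum lies below \<open>b\<close> exactly when some value
  does, whether or not the infimum is attained.\<close>

lemma inf_last_sublevel:
  assumes "\<And>x. x \<in> proj_last (Suc m) X \<Longrightarrow> bdd_below (fibre_values (Suc m) X f x)"
    and X: "X \<subseteq> rspace (Suc m)"
  shows "{x \<in> proj_last (Suc m) X. inf_last (Suc m) X f x < b} = proj_last (Suc m) {x \<in> X. f x < b}"
proof -
  have "{x \<in> X. f x < b} \<subseteq> rspace (Suc m)" using X by blast
  note eq = proj_last_Suc[OF this] proj_last_Suc[OF X]
  show ?thesis
    using inf_last_less_iff[OF _ assms(1) X] unfolding eq by blast
qed

text \<open>Reads off the output of \<open>definable_drop_penultimate\<close> for a graph: index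
  \<open>m\<close> of \<open>z\<close> carries the value, and \<open>t\<close> is the dropped
  argument.\<close>

lemma mem_graph_iff:
  assumes "X \<subseteq> rspace (Suc m)" "z \<in> rspace (Suc m)"
  shows "z(m := t, Suc m := z m) \<in> {x(Suc m := f x) | x. x \<in> X} \<longleftrightarrow>
    z(m := t) \<in> X \<and> z m = f (z(m := t))"
proof
  assume "z(m := t, Suc m := z m) \<in> {x(Suc m := f x) | x. x \<in> X}"
  then obtain y where y: "y \<in> X" "z(m := t, Suc m := z m) = y(Suc m := f y)" by blast
  have "y = (y(Suc m := f y))(Suc m := 0)"
    using y(1) assms(1) by (auto simp: topspace_Euclidean_space fun_eq_iff subset_iff)
  also have "\<dots> = z(m := t)"
    using assms(2) unfolding y(2)[symmetric] by (auto simp: topspace_Euclidean_space fun_eq_iff)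
  finally have "y = z(m := t)" .
  moreover have "z m = f y" using fun_cong[OF y(2), of "Suc m"] by simp
  ultimately show "z(m := t) \<in> X \<and> z m = f (z(m := t))" using y(1) by simp
qed auto

section \<open>Passing between a function, its slices and its fibre infima\<close>

context o_minimal_structure
begin

lemma semi_monotone_empty: "semi_monotone S n {}"
  using definable_compl[OF definable_rspace[of n]] by (simp add: semi_monotone_iff bounded_in_def)

text \<open>A converse to the projection and slice lemmas for sets with connected vertical fibres.
  The facts \<open>cyl\<close>, \<open>wall\<close> and \<open>side\<close> treat the three cases of
  \<open>coordinate_cone_SucE\<close>, the last one resting on the other two.\<close>

lemma semi_monotone_if_proj_slices:
  assumes Y: "openin (top_of_set (rspace (Suc m))) Y" "bounded_in (Suc m) Y" "Y \<in> S (Suc m)"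
    and fibres: "\<And>x. x \<in> rspace m \<Longrightarrow> connected (fibre_last (Suc m) Y x)"
    and proj: "semi_monotone S m (proj_last (Suc m) Y)"
    and slices: "\<And>a. semi_monotone S m (slice_last (Suc m) Y a)"
  shows "semi_monotone S (Suc m) Y"
proof -
  let ?\<pi> = "\<lambda>x :: nat \<Rightarrow> real. x(m := 0)" and ?P = "proj_last (Suc m) Y"
  have Yr: "Y \<subseteq> rspace (Suc m)" using Y(1) by (rule openin_imp_subset)
  have Pr: "?P \<subseteq> rspace m" using proj_last_Suc[OF Yr] by blast
  have cyl: "connected (Y \<inter> cylinder m C)" if C: "coordinate_cone m C" for C
  proof -
    have "connected (Y \<inter> ?\<pi> -` (?P \<inter> C))"
    proof (rule connected_open_monotone_preimage[OF continuous_on_fun_upd_const])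
      show "?\<pi> ` Y = ?P" by (simp add: proj_last_def)
      show "openin (top_of_set ?P) (?\<pi> ` U)" if U: "openin (top_of_set Y) U" for U
      proof -
        have "openin (top_of_set (rspace m)) (?\<pi> ` U)"
          using openin_proj_last[OF openin_trans[OF U Y(1)]] by (simp add: proj_last_def)
        moreover have "?\<pi> ` U \<subseteq> ?P"
          using openin_imp_subset[OF U] by (auto simp: proj_last_def)
        ultimately show ?thesis using Pr by (rule openin_subset_trans)
      qed
      show "connected (Y \<inter> ?\<pi> -` {y})" if y: "y \<in> ?P" for y
      proof -
        have yr: "y \<in> rspace m" using y Pr by blast
        have "Y \<inter> ?\<pi> -` {y} = (\<lambda>t. y(m := t)) ` fibre_last (Suc m) Y y"
        proof (intro equalityI subsetI)
          fix x assume "x \<in> Y \<inter> ?\<pi> -` {y}"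
          then have "x = y(m := x m)" "x \<in> Y" by auto
          then show "x \<in> (\<lambda>t. y(m := t)) ` fibre_last (Suc m) Y y"
            unfolding fibre_last_def diff_Suc_1 by (metis (mono_tags) imageI mem_Collect_eq)
        next
          fix x assume "x \<in> (\<lambda>t. y(m := t)) ` fibre_last (Suc m) Y y"
          then show "x \<in> Y \<inter> ?\<pi> -` {y}" using yr by (auto simp: fibre_last_def)
        qed
        then show ?thesis
          using connected_continuous_image[OF continuous_on_fun_upd_value fibres[OF yr]] by simp
      qed
      show "connected (?P \<inter> C)" using proj C by (simp add: semi_monotone_iff)
    qed auto
    moreover have "Y \<inter> ?\<pi> -` (?P \<inter> C) = Y \<inter> cylinder m C"
      using Yr by (auto simp: proj_last_def)
    ultimately show ?thesis by simp
  qed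
  have wall: "connected (Y \<inter> cylinder m C \<inter> {z. z m = a})" if C: "coordinate_cone m C" for C a
  proof -
    have "connected ((\<lambda>x. x(m := a)) ` (slice_last (Suc m) Y a \<inter> C))"
      using slices[of a] C
      by (intro connected_continuous_image continuous_on_fun_upd_const) (simp add: semi_monotone_iff)
    moreover have "(\<lambda>x. x(m := a)) ` (slice_last (Suc m) Y a \<inter> C) = Y \<inter> cylinder m C \<inter> {z. z m = a}"
    proof (intro equalityI subsetI)
      fix x assume "x \<in> (\<lambda>x. x(m := a)) ` (slice_last (Suc m) Y a \<inter> C)"
      then show "x \<in> Y \<inter> cylinder m C \<inter> {z. z m = a}" by auto
    next
      fix x assume x: "x \<in> Y \<inter> cylinder m C \<inter> {z. z m = a}"
      then have "x = (x(m := 0))(m := a)" by auto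
      moreover have "x(m := 0) \<in> slice_last (Suc m) Y a \<inter> C" using x by auto
      ultimately show "x \<in> (\<lambda>x. x(m := a)) ` (slice_last (Suc m) Y a \<inter> C)" by (rule image_eqI)
    qed
    ultimately show ?thesis by simp
  qed
  have side: "connected (Y \<inter> cylinder m C \<inter> {z. z m \<in> H})"
    if C: "coordinate_cone m C" and H: "H = {..<a} \<or> H = {a<..}" for C H a
  proof -
    obtain I where I: "\<forall>i. connected (I i)" "I m = UNIV" "cylinder m C = PiE UNIV I"
      using cylinder_box[OF C] by (elim exE conjE) (rule that)
    have H': "connected H" "open H" "closure H = insert a H" "a \<notin> H" using H by auto
    \<comment> \<open>The cone may contain equations, so the part of \<open>Y\<close> in the
      cylinder is open only relative to the cylinder; this is the openness in a box that
      \<open>connected_one_side\<close> asks for.\<close>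
    obtain T where "open T" "Y = rspace (Suc m) \<inter> T" using Y(1) unfolding openin_open by blast
    then have "Y \<inter> cylinder m C = cylinder m C \<inter> T" by blast
    then have "openin (top_of_set (PiE UNIV I)) (Y \<inter> cylinder m C)"
      unfolding I(3)[symmetric] using \<open>open T\<close> by (simp add: openin_open_Int)
    then show ?thesis
      by (rule connected_one_side[where I = I and j = m and c = a and H = H, OF I(1)[rule_format] I(2) _ cyl[OF C] wall[OF C] H'])
  qed
  have "connected (Y \<inter> C)" if "coordinate_cone (Suc m) C" for C
    using that
  proof (cases rule: coordinate_cone_SucE)
    case (1 C')
    then show ?thesis using cyl by simp
  next
    case (2 C' a)
    then show ?thesis using wall by (simp add: Int_assoc)
  next
    case (3 C' H a)
    then show ?thesis using side by (simp add: Int_assoc)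
  qed
  then show ?thesis using Y unfolding semi_monotone_iff by blast
qed

text \<open>The graph is cut by the hyperplane \<open>x m = a\<close>, after which the fixed
  argument is dropped.\<close>

lemma definable_fun_slice_last:
  assumes "definable_fun S (Suc m) X f"
  shows "definable_fun S m (slice_last (Suc m) X a) (\<lambda>x. f (x(m := a)))"
proof -
  let ?G = "{x(Suc m := f x) | x. x \<in> X}"
  have X: "X \<subseteq> rspace (Suc m)" and G: "?G \<in> S (Suc (Suc m))"
    using assms by (auto simp: definable_fun_def)
  have "is_interval {a}" by (simp add: is_interval_def)
  then have "?G \<inter> {x \<in> rspace (Suc (Suc m)). x m \<in> {a}} \<in> S (Suc (Suc m))" (is "?A \<in> _")
    by (intro definable_Int G definable_Collect_coord_interval) auto
  then have "{z \<in> rspace (Suc m). \<exists>t. z(m := t, Suc m := z m) \<in> ?A} \<in> S (Suc m)"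
    by (rule definable_drop_penultimate)
  moreover have "{z \<in> rspace (Suc m). \<exists>t. z(m := t, Suc m := z m) \<in> ?A} =
    {x(m := f (x(m := a))) | x. x \<in> slice_last (Suc m) X a}" (is "?L = ?R")
  proof (intro equalityI subsetI)
    fix z assume z: "z \<in> ?L"
    then obtain t where t: "z(m := t, Suc m := z m) \<in> ?A" by blast
    then have "t = a" by simp
    then have "z(m := a) \<in> X" "z m = f (z(m := a))"
      using t z mem_graph_iff[OF X, of z t f] by blast+
    then have "z = (z(m := 0))(m := f (z(m := 0, m := a)))" "z(m := 0) \<in> slice_last (Suc m) X a"
      using z by (auto simp: fun_eq_iff)
    then show "z \<in> ?R" by blast
  next
    fix z assume "z \<in> ?R"
    then obtain x where x: "x \<in> slice_last (Suc m) X a" "z = x(m := f (x(m := a)))" by blast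
    then have z: "z \<in> rspace (Suc m)" by simp
    have "z(m := a) = x(m := a)" "z m = f (x(m := a))" using x(2) by auto
    then have "z(m := a, Suc m := z m) \<in> ?G"
      using x(1) unfolding mem_graph_iff[OF X z] by simp
    moreover have "z(m := a, Suc m := z m) \<in> rspace (Suc (Suc m))"
      using z by (auto simp: topspace_Euclidean_space)
    ultimately show "z \<in> ?L" using z by (auto intro!: exI[of _ a])
  qed
  ultimately show ?thesis unfolding definable_fun_def by auto
qed

text \<open>Dropping the last argument from the graph leaves the set \<open>H\<close> of pairs of a
  base point and a value taken above it. Its fibres are the sets \<open>fibre_values\<close>, whose
  infima are definable.\<close>

lemma definable_fun_inf_last:
  assumes "definable_fun S (Suc m) X f"
    and bdd: "\<And>x. x \<in> proj_last (Suc m) X \<Longrightarrow> bdd_below (fibre_values (Suc m) X f x)"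
  shows "definable_fun S m (proj_last (Suc m) X) (inf_last (Suc m) X f)"
proof -
  let ?G = "{x(Suc m := f x) | x. x \<in> X}"
  have X: "X \<subseteq> rspace (Suc m)" and G: "?G \<in> S (Suc (Suc m))"
    using assms(1) by (auto simp: definable_fun_def)
  define H where "H = {z \<in> rspace (Suc m). \<exists>t. z(m := t, Suc m := z m) \<in> ?G}"
  have H: "H \<in> S (Suc m)" unfolding H_def using G by (rule definable_drop_penultimate)
  have H_eq: "H = {z \<in> rspace (Suc m). \<exists>t. z(m := t) \<in> X \<and> z m = f (z(m := t))}"
    unfolding H_def using mem_graph_iff[OF X] by blast
  have proj: "proj_last (Suc m) X = (\<lambda>x. x(m := 0)) ` H"
  proof (intro equalityI subsetI)
    fix x assume "x \<in> proj_last (Suc m) X"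
    then obtain t where t: "x \<in> rspace m" "x(m := t) \<in> X" unfolding proj_last_Suc[OF X] by blast
    then have "x(m := f (x(m := t))) \<in> H" unfolding H_eq by auto
    moreover have "x = (x(m := f (x(m := t))))(m := 0)" using t(1) by simp
    ultimately show "x \<in> (\<lambda>x. x(m := 0)) ` H" by (intro image_eqI)
  next
    fix x assume "x \<in> (\<lambda>x. x(m := 0)) ` H"
    then obtain z t where z: "z \<in> rspace (Suc m)" "z(m := t) \<in> X" "x = z(m := 0)"
      unfolding H_eq by blast
    then have "x(m := t) \<in> X" "x \<in> rspace m" by auto
    then show "x \<in> proj_last (Suc m) X" unfolding proj_last_Suc[OF X] by blast
  qed
  have vals: "{y. x(m := y) \<in> H} = fibre_values (Suc m) X f x" if "x \<in> proj_last (Suc m) X" for x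
    using that unfolding proj_last_Suc[OF X] H_eq fibre_values_def by auto
  have "definable_fun S m (proj_last (Suc m) X) (\<lambda>x. Inf {y. x(m := y) \<in> H})"
    using H proj by (rule definable_fun_Inf_fibres) (simp add: vals bdd)
  moreover have "{x(m := Inf {y. x(m := y) \<in> H}) | x. x \<in> proj_last (Suc m) X} =
      {x(m := inf_last (Suc m) X f x) | x. x \<in> proj_last (Suc m) X}"
    using vals unfolding inf_last_def by (metis (no_types, lifting))
  ultimately show ?thesis unfolding definable_fun_def by simp
qed

lemma submonotone_slice_last:
  assumes "submonotone S (Suc m) X f" "slice_last (Suc m) X a \<noteq> {}"
  shows "submonotone S m (slice_last (Suc m) X a) (\<lambda>x. f (x(m := a)))"
proof -
  have f: "definable_fun S (Suc m) X f" "bounded (f ` X)"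
      "\<And>b. semi_monotone S (Suc m) {x \<in> X. f x < b}"
    using assms(1) by (auto simp: submonotone_iff)
  have "(\<lambda>x. f (x(m := a))) ` slice_last (Suc m) X a \<subseteq> f ` X" by auto
  then have "bounded ((\<lambda>x. f (x(m := a))) ` slice_last (Suc m) X a)"
    using f(2) by (rule bounded_subset[rotated])
  moreover have "semi_monotone S m {x \<in> slice_last (Suc m) X a. f (x(m := a)) < b}" for b
  proof -
    have "{x \<in> slice_last (Suc m) X a. f (x(m := a)) < b} = slice_last (Suc m) {x \<in> X. f x < b} a"
      by auto
    then show ?thesis using semi_monotone_slice_last[OF f(3)] by (simp only:)
  qed
  ultimately show ?thesis
    unfolding submonotone_iff using assms(2) definable_fun_slice_last[OF f(1)] by blast
qed

text \<open>The sublevel sets of the infimum are projections of sublevel sets of \<open>f\<close>,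
  and a bound on \<open>f\<close> passes to it. Applied to \<open>- f\<close>, this yields the
  statement about suprema.\<close>

lemma submonotone_inf_last:
  assumes "submonotone S (Suc m) X f"
  shows "submonotone S m (proj_last (Suc m) X) (inf_last (Suc m) X f)"
    and "x \<in> proj_last (Suc m) X \<Longrightarrow>
      bdd_below (fibre_values (Suc m) X f x) \<and> bdd_above (fibre_values (Suc m) X f x)"
proof -
  have f: "X \<noteq> {}" "definable_fun S (Suc m) X f" "bounded (f ` X)"
      "\<And>b. semi_monotone S (Suc m) {x \<in> X. f x < b}"
    using assms(1) by (auto simp: submonotone_iff)
  have X: "X \<subseteq> rspace (Suc m)" using f(2) by (simp add: definable_fun_def)
  have sub: "fibre_values (Suc m) X f x \<subseteq> f ` X" for x
    by (auto simp: fibre_values_def)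
  then have bdd: "bdd_below (fibre_values (Suc m) X f x)" "bdd_above (fibre_values (Suc m) X f x)" for x
    using f(3) bounded_subset bounded_imp_bdd_below bounded_imp_bdd_above by metis+
  from bdd[of x] show "x \<in> proj_last (Suc m) X \<Longrightarrow>
      bdd_below (fibre_values (Suc m) X f x) \<and> bdd_above (fibre_values (Suc m) X f x)" by blast
  obtain B where B: "\<And>x. x \<in> X \<Longrightarrow> \<bar>f x\<bar> \<le> B" using f(3) by (auto simp: bounded_iff)
  have "\<bar>inf_last (Suc m) X f x\<bar> \<le> B" if x: "x \<in> proj_last (Suc m) X" for x
  proof -
    obtain t where t: "x(m := t) \<in> X" using x unfolding proj_last_Suc[OF X] by blast
    then have mem: "f (x(m := t)) \<in> fibre_values (Suc m) X f x" by (auto simp: fibre_values_def)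
    have "inf_last (Suc m) X f x \<le> f (x(m := t))"
      unfolding inf_last_def using mem bdd(1) by (rule cInf_lower)
    moreover have "-B \<le> y" if "y \<in> fibre_values (Suc m) X f x" for y
    proof -
      from that sub obtain z where "z \<in> X" "y = f z" by blast
      then show ?thesis using B[of z] by simp
    qed
    then have "- B \<le> inf_last (Suc m) X f x"
      unfolding inf_last_def using mem by (intro cInf_greatest) auto
    ultimately show ?thesis using B[OF t] by simp
  qed
  then have "bounded (inf_last (Suc m) X f ` proj_last (Suc m) X)"
    unfolding bounded_iff by (intro exI[of _ B]) auto
  moreover have "semi_monotone S m {x \<in> proj_last (Suc m) X. inf_last (Suc m) X f x < b}" for b
    unfolding inf_last_sublevel[OF bdd(1) X] using f(4) by (rule semi_monotone_proj_last)
  ultimately show "submonotone S m (proj_last (Suc m) X) (inf_last (Suc m) X f)"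
    unfolding submonotone_iff
    using f(1) definable_fun_inf_last[OF f(2) bdd(1)] by (auto simp: proj_last_def)
qed

text \<open>A single point is a cone with all coordinates fixed, so the cylinder over it, a vertical
  line, meets \<open>X\<close> in a connected set. Openness and boundedness of \<open>X\<close> make
  this an open interval.\<close>

lemma semi_monotone_fibre_last:
  assumes "semi_monotone S (Suc m) X" "x \<in> rspace m"
  shows "fibre_last (Suc m) X x = {} \<or> (\<exists>a b. a < b \<and> fibre_last (Suc m) X x = {a<..<b})"
proof -
  let ?F = "fibre_last (Suc m) X x"
  have X: "openin (top_of_set (rspace (Suc m))) X" "bounded_in (Suc m) X"
    "\<And>C. coordinate_cone (Suc m) C \<Longrightarrow> connected (X \<inter> C)"
    using assms unfolding semi_monotone_iff by blast+
  have cone: "coordinate_cone m {x}"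
    unfolding coordinate_cone_def
  proof (intro exI conjI)
    show "{x} = {z \<in> rspace m. \<forall>j\<in>{..<m}. (=) (z j) (x j)}"
      using assms(2) by (auto simp: topspace_Euclidean_space fun_eq_iff) (metis lessThan_iff not_le)
  qed auto
  have "connected ((\<lambda>z. z m) ` (X \<inter> cylinder m {x}))"
    by (intro connected_continuous_image X coordinate_cone_cylinder(1)[OF cone]
        continuous_on_subset[OF continuous_on_product_coordinates subset_UNIV])
  moreover have "(\<lambda>z. z m) ` (X \<inter> cylinder m {x}) = ?F"
  proof (intro equalityI subsetI)
    fix t assume "t \<in> (\<lambda>z. z m) ` (X \<inter> cylinder m {x})"
    then obtain z where "z \<in> X" "z(m := 0) = x" "t = z m" by auto
    then show "t \<in> ?F" by (auto simp: fibre_last_def)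
  next
    fix t assume "t \<in> ?F"
    then show "t \<in> (\<lambda>z. z m) ` (X \<inter> cylinder m {x})"
      using assms(2) by (intro image_eqI[of _ _ "x(m := t)"]) (auto simp: fibre_last_def)
  qed
  ultimately have "connected ?F" by simp
  moreover have "open ?F"
  proof -
    have "openin (top_of_set UNIV) (UNIV \<inter> (\<lambda>t. x(m := t)) -` X)"
      using assms(2) X(1) by (intro continuous_openin_preimage[OF continuous_on_fun_upd_value]) auto
    then show ?thesis by (simp add: fibre_last_def vimage_def)
  qed
  moreover have "bounded ?F"
  proof -
    obtain B where B: "\<And>x. x \<in> X \<Longrightarrow> L2_set x {..<Suc m} \<le> B"
      using X(2) by (auto simp: bounded_in_def)
    have "\<bar>t\<bar> \<le> B" if "t \<in> ?F" for t
    proof -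
      have "\<bar>(x(m := t)) m\<bar> \<le> L2_set (\<lambda>i. \<bar>(x(m := t)) i\<bar>) {..<Suc m}"
        by (rule member_le_L2_set) auto
      also have "\<dots> = L2_set (x(m := t)) {..<Suc m}" by (simp add: L2_set_def)
      also have "\<dots> \<le> B" using that B by (simp add: fibre_last_def)
      finally show ?thesis by simp
    qed
    then show ?thesis unfolding bounded_iff by auto
  qed
  ultimately show ?thesis using open_bounded_connected_real by blast
qed

text \<open>Strict monotonicity or independence in the last variable keeps the fibres of the sublevel
  sets connected.\<close>

lemma submonotone_if_inf_last_slices:
  assumes X: "X \<noteq> {}" "openin (top_of_set (rspace (Suc m))) X" "bounded_in (Suc m) X"
    and f: "continuous_on X f" "definable_fun S (Suc m) X f" "bounded (f ` X)"
    and last: "strictly_increasing_in m X f \<or> strictly_decreasing_in m X f \<or> independent_of m X f"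
    and fibres: "\<And>x. x \<in> rspace m \<Longrightarrow> connected (fibre_last (Suc m) X x)"
    and bdd: "\<And>x. x \<in> proj_last (Suc m) X \<Longrightarrow> bdd_below (fibre_values (Suc m) X f x)"
    and inf: "submonotone S m (proj_last (Suc m) X) (inf_last (Suc m) X f)"
    and slices: "\<And>a. slice_last (Suc m) X a \<noteq> {} \<Longrightarrow>
      submonotone S m (slice_last (Suc m) X a) (\<lambda>x. f (x(m := a)))"
  shows "submonotone S (Suc m) X f"
proof -
  have Xr: "X \<subseteq> rspace (Suc m)" using X(2) by (rule openin_imp_subset)
  have "semi_monotone S (Suc m) {x \<in> X. f x < b}" (is "semi_monotone S _ ?Y") for b
  proof (rule semi_monotone_if_proj_slices)
    have "openin (top_of_set X) (X \<inter> f -` {..<b})"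
      using f(1) by (rule continuous_openin_preimage_gen) simp
    moreover have "X \<inter> f -` {..<b} = ?Y" by auto
    ultimately show "openin (top_of_set (rspace (Suc m))) ?Y" using X(2) openin_trans by metis
    show "bounded_in (Suc m) ?Y" using X(3) by (rule bounded_in_subset) auto
    have "{x \<in> X. f x \<in> {..<b}} \<in> S (Suc m)"
      using f(2) by (rule definable_fun_Collect_interval) (simp add: is_interval_connected_1)
    then show "?Y \<in> S (Suc m)" by simp
    show "semi_monotone S m (proj_last (Suc m) ?Y)"
    proof -
      have "semi_monotone S m {x \<in> proj_last (Suc m) X. inf_last (Suc m) X f x < b}"
        using inf unfolding submonotone_iff by blast
      also have "{x \<in> proj_last (Suc m) X. inf_last (Suc m) X f x < b} = proj_last (Suc m) ?Y"
        by (rule inf_last_sublevel[OF _ Xr]) (rule bdd)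
      finally show ?thesis .
    qed
    show "semi_monotone S m (slice_last (Suc m) ?Y a)" for a
    \<comment> \<open>The assumption on slices speaks only of non-empty ones; over other
      \<open>a\<close> the sublevel set has an empty slice, which is semi-monotone.\<close>
    proof (cases "slice_last (Suc m) X a = {}")
      case True
      then have "slice_last (Suc m) ?Y a = {}" by auto
      then show ?thesis by (simp only: semi_monotone_empty)
    next
      case False
      then have "semi_monotone S m {x \<in> slice_last (Suc m) X a. f (x(m := a)) < b}"
        using slices unfolding submonotone_iff by blast
      also have "{x \<in> slice_last (Suc m) X a. f (x(m := a)) < b} = slice_last (Suc m) ?Y a" by auto
      finally show ?thesis .
    qed
    show "connected (fibre_last (Suc m) ?Y x)" if x: "x \<in> rspace m" for x
      unfolding is_interval_connected_1[symmetric] is_interval_1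
    proof (intro ballI allI impI)
      fix r s t assume r: "r \<in> fibre_last (Suc m) ?Y x" and s: "s \<in> fibre_last (Suc m) ?Y x"
        and t: "r \<le> t \<and> t \<le> s"
      have "is_interval (fibre_last (Suc m) X x)"
        using fibres[OF x] by (simp add: is_interval_connected_1)
      moreover have "r \<in> fibre_last (Suc m) X x" "s \<in> fibre_last (Suc m) X x"
        using r s by (auto simp: fibre_last_def)
      ultimately have tX: "t \<in> fibre_last (Suc m) X x"
        using t unfolding is_interval_1 by blast
      have "f (x(m := t)) < b"
      proof (cases "t = r \<or> t = s")
        case True
        then show ?thesis using r s by (auto simp: fibre_last_def)
      next
        case False
        then have rt: "r < t" "t < s" using t by auto
        have mem: "x(m := r) \<in> X" "x(m := t) \<in> X" "x(m := s) \<in> X" "f (x(m := r)) < b" "f (x(m := s)) < b"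
          using r s tX by (auto simp: fibre_last_def)
        have "f (x(m := t)) \<le> f (x(m := r)) \<or> f (x(m := t)) \<le> f (x(m := s))"
          using last
        proof (elim disjE)
          assume "strictly_increasing_in m X f"
          then have "f (x(m := t)) < f (x(m := s))"
            unfolding strictly_increasing_in_def using mem(2,3) rt by simp
          then show ?thesis by simp
        next
          assume "strictly_decreasing_in m X f"
          then have "f (x(m := r)) > f (x(m := t))"
            unfolding strictly_decreasing_in_def using mem(1,2) rt by simp
          then show ?thesis by simp
        next
          assume "independent_of m X f"
          then have "f (x(m := r)) = f (x(m := t))"
            unfolding independent_of_def using mem(1,2) rt by simp
          then show ?thesis by simp
        qed
        then show ?thesis using mem(4,5) by linarith
      qed
      then show "t \<in> fibre_last (Suc m) ?Y x" using tX by (simp add: fibre_last_def)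
    qed
  qed
  then show ?thesis using X(1) f(2,3) unfolding submonotone_iff by blast
qed

end

section \<open>Assembling the equivalence from the statements for \<open>f\<close> and for
  \<open>- f\<close>\<close>

theorem theorem2p18:
  fixes S :: "nat \<Rightarrow> (nat \<Rightarrow> real) set set"
    and n :: nat
    and X :: "(nat \<Rightarrow> real) set"
    and f :: "(nat \<Rightarrow> real) \<Rightarrow> real"
  assumes "o_minimal_structure S"
    and "n \<ge> 1"
    and "X \<noteq> {}" and "openin (Euclidean_space n) X" and "bounded_in n X" and "X \<in> S n"
    and "continuous_map (subtopology (Euclidean_space n) X) euclideanreal f"
    and "definable_fun S n X f"
    and "\<not> independent_of (n - 1) X f"
  shows "monotone_fun S n X f \<longleftrightarrow>
     coordinatewise_monotone n X f \<and>
     ((\<forall>x' \<in> proj_last n X. bdd_below (fibre_values n X f x') \<and> bdd_above (fibre_values n X f x')) \<and>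
       submonotone S (n - 1) (proj_last n X) (inf_last n X f) \<and>
       supermonotone S (n - 1) (proj_last n X) (sup_last n X f)) \<and>
     (\<forall>x' \<in> rspace (n - 1).
       fibre_last n X x' = {} \<or> (\<exists>a b. a < b \<and> fibre_last n X x' = {a<..<b})) \<and>
     (\<forall>a. slice_last n X a \<noteq> {} \<longrightarrow>
       monotone_fun S (n - 1) (slice_last n X a) (\<lambda>x'. f (x'(n - 1 := a))))"
proof -
  interpret o_minimal_structure S by fact
  obtain m where n: "n = Suc m" using assms(2) by (cases n) auto
  let ?P = "proj_last (Suc m) X" and ?f' = "\<lambda>x. - f x"
  note ne = assms(3)
  have opX: "openin (top_of_set (rspace (Suc m))) X"
    using assms(4) unfolding n openin_Euclidean_space .
  have XS: "X \<in> S (Suc m)" using assms(6) n by simp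
  have fS: "definable_fun S (Suc m) X f" using assms(8) n by simp
  have bdX: "bounded_in (Suc m) X" using assms(5) n by simp
  have Xr: "X \<subseteq> rspace (Suc m)" using opX by (rule openin_imp_subset)
  have cont: "continuous_on X f"
  proof -
    have "subtopology (Euclidean_space n) X = top_of_set X"
      unfolding n Euclidean_space_def euclidean_product_topology subtopology_subtopology
      using Xr by (simp add: topspace_Euclidean_space Int_absorb1)
    then show ?thesis using assms(7) by simp
  qed
  have cont': "continuous_on X ?f'" using cont by (rule continuous_on_minus)
  \<comment> \<open>Turns the condition on suprema into one on infima of \<open>- f\<close>, so both
    directions apply the same lemmas once to \<open>f\<close> and once to
    \<open>- f\<close>.\<close>
  have sup_inf: "supermonotone S m ?P (sup_last (Suc m) X f) \<longleftrightarrow>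
      submonotone S m ?P (inf_last (Suc m) X ?f')"
    unfolding supermonotone_def sup_last_conv_inf_last[symmetric] fun_Compl_def ..
  have vals: "fibre_values (Suc m) X ?f' x = uminus ` fibre_values (Suc m) X f x" for x
    unfolding fibre_values_def by blast
  show ?thesis
    unfolding n diff_Suc_1
  proof (intro iffI conjI ballI allI impI)
    assume mono: "monotone_fun S (Suc m) X f"
    then have sub: "submonotone S (Suc m) X f" and super: "submonotone S (Suc m) X ?f'"
      and coord: "coordinatewise_monotone (Suc m) X f" and smX: "semi_monotone S (Suc m) X"
      unfolding monotone_fun_def supermonotone_def by blast+
    show "coordinatewise_monotone (Suc m) X f" by fact
    show "submonotone S m ?P (inf_last (Suc m) X f)"
      using sub by (rule submonotone_inf_last)
    show "supermonotone S m ?P (sup_last (Suc m) X f)"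
      unfolding sup_inf using super by (rule submonotone_inf_last)
    show "bdd_below (fibre_values (Suc m) X f x)" "bdd_above (fibre_values (Suc m) X f x)"
      if "x \<in> ?P" for x
      using submonotone_inf_last(2)[OF sub that] by simp_all
    show "fibre_last (Suc m) X x = {} \<or> (\<exists>a b. a < b \<and> fibre_last (Suc m) X x = {a<..<b})"
      if "x \<in> rspace m" for x
      using smX that by (rule semi_monotone_fibre_last)
    show "monotone_fun S m (slice_last (Suc m) X a) (\<lambda>x'. f (x'(m := a)))"
      if "slice_last (Suc m) X a \<noteq> {}" for a
    proof -
      \<comment> \<open>Points of a slice that differ only at some \<open>j < m\<close> still do so
        after index \<open>m\<close> is set to \<open>a\<close>, so each coordinate keeps its
        type.\<close>
      have "coordinatewise_monotone m (slice_last (Suc m) X a) (\<lambda>x. f (x(m := a)))"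
        unfolding coordinatewise_monotone_def
      proof (intro allI impI)
        fix j assume j: "j < m"
        then consider "strictly_increasing_in j X f" | "strictly_decreasing_in j X f"
          | "independent_of j X f"
          using coord unfolding coordinatewise_monotone_def by (meson less_SucI)
        then show "strictly_increasing_in j (slice_last (Suc m) X a) (\<lambda>x. f (x(m := a))) \<or>
          strictly_decreasing_in j (slice_last (Suc m) X a) (\<lambda>x. f (x(m := a))) \<or>
          independent_of j (slice_last (Suc m) X a) (\<lambda>x. f (x(m := a)))"
          using j
          by cases (simp_all add: strictly_increasing_in_def strictly_decreasing_in_def independent_of_def)
      qed
      then show ?thesis
        unfolding monotone_fun_def supermonotone_def
        using that semi_monotone_slice_last[OF smX] definable_fun_slice_last[OF fS]
          submonotone_slice_last[OF sub that] submonotone_slice_last[OF super that] by blast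
    qed
  next
    assume R: "coordinatewise_monotone (Suc m) X f \<and>
      ((\<forall>x\<in>?P. bdd_below (fibre_values (Suc m) X f x) \<and> bdd_above (fibre_values (Suc m) X f x)) \<and>
       submonotone S m ?P (inf_last (Suc m) X f) \<and>
       supermonotone S m ?P (sup_last (Suc m) X f)) \<and>
      (\<forall>x\<in>rspace m. fibre_last (Suc m) X x = {} \<or>
        (\<exists>a b. a < b \<and> fibre_last (Suc m) X x = {a<..<b})) \<and>
      (\<forall>a. slice_last (Suc m) X a \<noteq> {} \<longrightarrow>
        monotone_fun S m (slice_last (Suc m) X a) (\<lambda>x'. f (x'(m := a))))"
    note fib_bdd = R[THEN conjunct2, THEN conjunct1, THEN conjunct1, rule_format]
    have inf: "submonotone S m ?P (inf_last (Suc m) X f)" using R by blast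
    have inf': "submonotone S m ?P (inf_last (Suc m) X ?f')" using R sup_inf by blast
    have bdd: "bdd_below (fibre_values (Suc m) X f x)" if "x \<in> ?P" for x using fib_bdd[OF that] by simp
    have bdd': "bdd_below (fibre_values (Suc m) X ?f' x)" if "x \<in> ?P" for x
      unfolding vals bdd_below_uminus using fib_bdd[OF that] by simp
    have fibres: "connected (fibre_last (Suc m) X x)" if "x \<in> rspace m" for x
    proof -
      have "fibre_last (Suc m) X x = {} \<or> (\<exists>a b. fibre_last (Suc m) X x = {a<..<b})"
        using R[THEN conjunct2, THEN conjunct2, THEN conjunct1, rule_format, OF that] by blast
      then show ?thesis by auto
    qed
    have slices: "submonotone S m (slice_last (Suc m) X a) (\<lambda>x. f (x(m := a)))"
      "submonotone S m (slice_last (Suc m) X a) (\<lambda>x. - f (x(m := a)))"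
      if "slice_last (Suc m) X a \<noteq> {}" for a
      using R[THEN conjunct2, THEN conjunct2, THEN conjunct2, rule_format, OF that]
      by (simp_all add: monotone_fun_def supermonotone_def)
    have last: "strictly_increasing_in m X f \<or> strictly_decreasing_in m X f \<or> independent_of m X f"
      using R unfolding coordinatewise_monotone_def by (meson lessI)
    then have last': "strictly_increasing_in m X ?f' \<or> strictly_decreasing_in m X ?f' \<or> independent_of m X ?f'"
      unfolding strictly_increasing_in_def strictly_decreasing_in_def independent_of_def
      by (elim disjE) simp_all
    \<comment> \<open>Boundedness of \<open>f\<close> comes from the two infima: \<open>f x\<close>
      lies above that of \<open>f\<close> and \<open>- f x\<close> above that of \<open>- f\<close>,
      and both infima are bounded functions on the projection.\<close>
    obtain B B' where B: "\<forall>x\<in>?P. \<bar>inf_last (Suc m) X f x\<bar> \<le> B"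
        "\<forall>x\<in>?P. \<bar>inf_last (Suc m) X ?f' x\<bar> \<le> B'"
      using inf inf' unfolding submonotone_iff bounded_iff by auto
    have "\<bar>f x\<bar> \<le> max B B'" if x: "x \<in> X" for x
    proof -
      have P: "x(m := 0) \<in> ?P" using x by (simp add: proj_last_def)
      have "f x \<in> fibre_values (Suc m) X f (x(m := 0))" "?f' x \<in> fibre_values (Suc m) X ?f' (x(m := 0))"
        using x by (auto simp: fibre_values_def intro!: exI[of _ "x m"])
      then have "inf_last (Suc m) X f (x(m := 0)) \<le> f x" "inf_last (Suc m) X ?f' (x(m := 0)) \<le> ?f' x"
        unfolding inf_last_def using bdd[OF P] bdd'[OF P] by (auto intro: cInf_lower)
      then show ?thesis using B[rule_format, OF P] by linarith
    qed
    then have bf: "bounded (f ` X)" "bounded (?f' ` X)" unfolding bounded_iff by auto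
    have sub: "submonotone S (Suc m) X f"
      by (rule submonotone_if_inf_last_slices[OF ne opX bdX cont fS bf(1) last fibres bdd inf slices(1)])
    moreover have "submonotone S (Suc m) X ?f'"
      by (rule submonotone_if_inf_last_slices[OF ne opX bdX cont' definable_fun_uminus[OF fS] bf(2)
            last' fibres bdd' inf' slices(2)])
    \<comment> \<open>Semi-monotonicity of \<open>X\<close> itself is obtained by unfolding
      submonotonicity of \<open>f\<close>.\<close>
    ultimately show "monotone_fun S (Suc m) X f"
      using R ne fS unfolding monotone_fun_def supermonotone_def submonotone_def by blast
  qed
qed

end
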